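(* Let $n\ge2$, $\alpha\in(0,1)$ and $\beta\in\mathbb R$ with $\beta\ne0$. Let $f(z)=|z|^{\beta-1}z$ for $z\in\mathbb R^n\setminus\{0\}$. Then the composition operator ${\bf C}_f$ is bounded on $Q_\alpha(\mathbb R^n)$. In particular, $Q_\alpha(\mathbb R^n)$ is conformally invariant in the sense that $g\in Q_\alpha(\mathbb R^n)$ if and only if the function $x\mapsto g(x|x|^{-2})$ is in $Q_\alpha(\mathbb R^n)$.
   Context: For $\alpha\in(0,1)$, $Q_\alpha(\mathbb R^n)$ consists of all $u\in L^2_{\rm loc}(\mathbb R^n)$ with $$\|u\|_{Q_\alpha(\mathbb R^n)}=\sup_{x_0\in\mathbb R^n,\,r>0}\left(r^{2\alpha-n}\int_{B(x_0,r)}\int_{B(x_0,r)}\frac{|u(x)-u(y)|^2}{|x-y|^{n+2\alpha}}\,dx\,dy\right)^{1/2}<\infty .$$ The composition operator is ${\bf C}_f(u)=u\circ f$ (functions are defined almost everywhere, so the value at the origin is irrelevant). It is bounded on $Q_\alpha(\mathbb R^n)$ if there is a constant $C$ such that $u\circ f\in Q_\alpha(\mathbb R^n)$ and $\|u\circ f\|_{Q_\alpha(\mathbb R^n)}\le C\|u\|_{Q_\alpha(\mathbb R^n)}$ for all $u\in Q_\alpha(\mathbb R^n)$. *)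

theory Defs
  imports "HOL-Analysis.Analysis"
begin

text \<open>
  Functions defined almost everywhere on \<open>\<real>\<^sup>n\<close> are represented by total functions
  \<open>real ^ 'n \<Rightarrow> real\<close>; membership in \<open>L2_loc\<close> and the value of \<open>Q_norm\<close> do not
  depend on the choice of the representative.
\<close>

definition L2_loc :: "(real ^ 'n \<Rightarrow> real) set" where
  "L2_loc = {u. u \<in> borel_measurable lebesgue \<and>
                (\<forall>K. compact K \<longrightarrow> set_integrable lebesgue K (\<lambda>x. (u x)\<^sup>2))}"

definition ennreal_sqrt :: "ennreal \<Rightarrow> ennreal" where
  "ennreal_sqrt a = (if a = \<infinity> then \<infinity> else ennreal (sqrt (enn2real a)))"

text \<open>
  The integrals are nonnegative Lebesgue integrals with values in \<open>[0, \<infinity>]\<close>, so the supremum always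
  exists. On the diagonal the integrand is \<open>0 / 0 = 0\<close>; the diagonal is a null set.
\<close>

definition Q_norm :: "real \<Rightarrow> (real ^ 'n \<Rightarrow> real) \<Rightarrow> ennreal" where
  "Q_norm \<alpha> u =
     (SUP (x0, r) \<in> UNIV \<times> {0<..}.
        ennreal_sqrt
          (ennreal (r powr (2 * \<alpha> - real CARD('n))) *
           (\<integral>\<^sup>+ y \<in> ball x0 r.
              (\<integral>\<^sup>+ x \<in> ball x0 r.
                 ennreal (\<bar>u x - u y\<bar>\<^sup>2 / norm (x - y) powr (real CARD('n) + 2 * \<alpha>))
               \<partial>lebesgue)
            \<partial>lebesgue)))"

definition Q_space :: "real \<Rightarrow> (real ^ 'n \<Rightarrow> real) set" where
  "Q_space \<alpha> = {u \<in> L2_loc. Q_norm \<alpha> u < \<infinity>}"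

definition composition_operator ::
    "(real ^ 'n \<Rightarrow> real ^ 'n) \<Rightarrow> (real ^ 'n \<Rightarrow> real) \<Rightarrow> (real ^ 'n \<Rightarrow> real)" where
  "composition_operator f u = u \<circ> f"

definition bounded_on_Q ::
    "real \<Rightarrow> ((real ^ 'n \<Rightarrow> real) \<Rightarrow> (real ^ 'n \<Rightarrow> real)) \<Rightarrow> bool" where
  "bounded_on_Q \<alpha> T \<longleftrightarrow>
     (\<exists>C::real. C \<ge> 0 \<and>
        (\<forall>u \<in> Q_space \<alpha>. T u \<in> Q_space \<alpha> \<and> Q_norm \<alpha> (T u) \<le> ennreal C * Q_norm \<alpha> u))"

end

(*
  On a shell {sigma/q <= |x| <= q sigma} the map f is Lipschitz with constant comparable to
  sigma^(beta-1), and so is its inverse z |-> |z|^(1/beta-1) z with the reciprocal constant, so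
  the change of variables bounds the energy of u o f on a subset of a ball in the shell by
  the energy of u on a ball of comparable size.  This settles balls far from the origin.  A ball near the
  origin lies in a comparable ball B(0, R), which is cut into the dyadic annuli A_j of radius R 2^-j.
  Neighbouring annuli lie in a common shell; for A_j and A_(j+m) with m >= 2 the kernel is at most a multiple of
  (R 2^-j)^-(n+2 alpha), and the L2 oscillation of u o f between them is controlled by telescoping through
  the annuli in between.  The resulting bound decays geometrically in j because n > 2 alpha, and in m because n >= 2.
*)
theory Submission
  imports Defs
begin

section \<open>Measure of Lipschitz images\<close>

text \<open>The obstacle is the origin: for negative \<open>\<beta>\<close> the image of a punctured
  ball around it is a neighbourhood of infinity, so no single ball of comparable size controls the
  energy there, and the local Lipschitz constant scales like
  \<open>norm x powr (\<beta> - 1)\<close>. Only upper bounds are wanted, so no Jacobian is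
  computed: a Lipschitz bound for the inverse map bounds the measure of preimages, at the price of a
  crude dimensional constant. Oscillation is measured by double integrals of
  \<open>\<bar>u x - u y\<bar>\<^sup>2\<close> rather than by mean values. Thus the estimates for
  the composed function need only its measurability. Its local square integrability cannot be
  transported from \<open>u\<close>, since for negative \<open>\<beta>\<close> it depends on
  \<open>u\<close> near infinity; it is recovered at the end from the finite energy.\<close>

lemma Lipschitz_image_lebesgue:
  fixes g :: "'a::euclidean_space \<Rightarrow> 'a"
  assumes E: "E \<in> sets lebesgue"
    and lip: "\<And>x y. x \<in> E \<Longrightarrow> y \<in> E \<Longrightarrow> norm (g x - g y) \<le> L * norm (x - y)"
  shows "g ` E \<in> sets lebesgue"
proof (rule sets_lebesgue_continuous_image [OF E])
  show "continuous_on E g"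
  proof (rule lipschitz_on_continuous_on)
    show "(max L 0)-lipschitz_on E g"
    proof (rule lipschitz_onI)
      fix x y assume "x \<in> E" "y \<in> E"
      then have "norm (g x - g y) \<le> L * norm (x - y)" by (rule lip)
      also have "\<dots> \<le> max L 0 * norm (x - y)" by (intro mult_right_mono) auto
      finally show "dist (g x) (g y) \<le> max L 0 * dist x y" by (simp add: dist_norm)
    qed auto
  qed
next
  fix T assume T: "negligible T" "T \<subseteq> E"
  show "negligible (g ` T)"
  proof (rule negligible_locally_Lipschitz_image)
    show "\<exists>U B. open U \<and> x \<in> U \<and> (\<forall>y \<in> T \<inter> U. norm (g y - g x) \<le> B * norm (y - x))"
      if "x \<in> T" for x
      using that T lip by (intro exI[of _ UNIV] exI[of _ L]) auto
  qed (use T in auto)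
qed simp

text \<open>Cover \<open>E\<close> by nonoverlapping cubes inside an open set that exceeds
  \<open>E\<close> by little measure. The part of \<open>E\<close> in a cube of side s has diameter
  at most \<open>DIM('a)\<close> times s, so its image lies in a cube of side
  \<open>2 * L * DIM('a)\<close> times s.\<close>

lemma emeasure_Lipschitz_image_le:
  fixes g :: "'a::euclidean_space \<Rightarrow> 'a"
  assumes E: "E \<in> sets lebesgue" and bdd: "bounded E" and L: "0 \<le> L"
    and lip: "\<And>x y. x \<in> E \<Longrightarrow> y \<in> E \<Longrightarrow> norm (g x - g y) \<le> L * norm (x - y)"
  shows "emeasure lebesgue (g ` E) \<le> ennreal ((2 * L * DIM('a)) ^ DIM('a)) * emeasure lebesgue E"
proof -
  define C where "C = (2 * L * DIM('a)) ^ DIM('a)"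
  have C: "0 \<le> C" using L by (simp add: C_def)
  obtain b where b: "b > 0" "E \<subseteq> cbox (- (b *\<^sub>R One)) (b *\<^sub>R One :: 'a)"
  proof -
    obtain a where a: "E \<subseteq> cbox (-a) a" using bounded_subset_cbox_symmetric[OF bdd] by blast
    define b where "b = norm a + 1"
    have "cbox (-a) a \<subseteq> cbox (- (b *\<^sub>R One)) (b *\<^sub>R One :: 'a)"
    proof (intro subset_box_imp)
      show "\<forall>i\<in>Basis. - (b *\<^sub>R One) \<bullet> i \<le> - a \<bullet> i \<and> a \<bullet> i \<le> b *\<^sub>R One \<bullet> (i::'a)"
      proof
        fix i :: 'a assume i: "i \<in> Basis"
        have "\<bar>a \<bullet> i\<bar> \<le> b" using Basis_le_norm[OF i, of a] by (simp add: b_def)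
        then show "- (b *\<^sub>R One) \<bullet> i \<le> - a \<bullet> i \<and> a \<bullet> i \<le> b *\<^sub>R One \<bullet> i"
          using i by (auto simp: abs_le_iff inner_sum_left inner_Basis if_distrib sum.delta cong: if_cong)
      qed
    qed
    with a that[of b] show ?thesis by (auto simp: b_def add_nonneg_pos)
  qed
  have main: "emeasure lebesgue (g ` E) \<le> ennreal C * (emeasure lebesgue E + ennreal e)" if e: "e > 0" for e
  proof -
    \<comment> \<open>The gauge built from \<open>U\<close> forces every covering cube that meets
      \<open>E\<close> into \<open>U\<close>, so the total volume of the cubes exceeds that of
      \<open>E\<close> by at most \<open>e\<close>.\<close>
    obtain U where U: "open U" "E \<subseteq> U" "(U - E) \<in> lmeasurable" "emeasure lebesgue (U - E) < ennreal e"
      using sets_lebesgue_outer_open[OF E e] by blast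
    have "\<exists>d>0. x \<in> U \<longrightarrow> ball x d \<subseteq> U" for x
      using U(1) by (metis openE zero_less_one)
    then obtain d where d: "\<And>x. d x > 0" "\<And>x. x \<in> U \<Longrightarrow> ball x (d x) \<subseteq> U" by metis
    have box: "box (- (b *\<^sub>R One)) (b *\<^sub>R One :: 'a) \<noteq> {}"
      using b by (auto simp: box_ne_empty inner_sum_left inner_Basis if_distrib sum.delta cong: if_cong)
    have gauge: "gauge (\<lambda>x. ball x (d x))" using d(1) by (simp add: gauge_ball_dependent)
    obtain D where D': "countable D" "\<Union>D \<subseteq> cbox (- (b *\<^sub>R One)) (b *\<^sub>R One)"
        "\<And>K. K \<in> D \<Longrightarrow> interior K \<noteq> {} \<and> (\<exists>c d. K = cbox c d)"
        "pairwise (\<lambda>A B. interior A \<inter> interior B = {}) D"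
        "\<And>K. K \<in> D \<Longrightarrow> \<exists>x \<in> E \<inter> K. K \<subseteq> ball x (d x)"
        "\<And>u v. cbox u v \<in> D \<Longrightarrow> \<exists>n. \<forall>i \<in> Basis. v \<bullet> i - u \<bullet> i = ((b *\<^sub>R One) \<bullet> i - (- (b *\<^sub>R One)) \<bullet> i) / 2^n"
        "E \<subseteq> \<Union>D"
      by (rule covering_lemma[OF b(2) box gauge]) (rule that)
    note D = D'(1,3-7)
    have Kleb: "K \<in> sets lebesgue" if "K \<in> D" for K using D(2)[OF that] by auto
    have cube: "emeasure lebesgue (g ` (E \<inter> K)) \<le> ennreal C * emeasure lebesgue K" if K: "K \<in> D" for K
    proof -
      obtain p q where pq: "K = cbox p q" using D(2)[OF K] by blast
      obtain n where n: "\<And>i. i \<in> Basis \<Longrightarrow> q \<bullet> i - p \<bullet> i = ((b *\<^sub>R One) \<bullet> i - (- (b *\<^sub>R One)) \<bullet> i) / 2^n"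
        using D(5) K pq by metis
      define s where "s = 2 * b / 2 ^ n"
      have s: "s > 0" using b by (simp add: s_def)
      have side: "q \<bullet> i - p \<bullet> i = s" if "i \<in> Basis" for i
        using n[OF that] that by (simp add: s_def inner_sum_left inner_Basis if_distrib sum.delta cong: if_cong)
      have eK: "emeasure lebesgue K = ennreal (s ^ DIM('a))"
      proof -
        have "emeasure lborel (cbox p q) = ennreal (\<Prod>i\<in>Basis. (q - p) \<bullet> i)"
          by (rule emeasure_lborel_cbox) (use side s in \<open>fastforce\<close>)
        also have "(\<Prod>i\<in>Basis. (q - p) \<bullet> i) = s ^ DIM('a)"
          using side by (simp add: inner_diff_left)
        finally show ?thesis by (simp add: pq)
      qed
      obtain x where x: "x \<in> E" "x \<in> K" using D(4)[OF K] by blast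
      define t where "t = L * (DIM('a) * s)"
      have t: "t \<ge> 0" using L s by (simp add: t_def)
      have "g ` (E \<inter> K) \<subseteq> cbox (g x - t *\<^sub>R One) (g x + t *\<^sub>R One)"
      proof clarify
        fix y assume y: "y \<in> E" "y \<in> K"
        have "norm (y - x) \<le> (\<Sum>i\<in>Basis. \<bar>(y - x) \<bullet> i\<bar>)" by (rule norm_le_l1)
        also have "\<dots> \<le> (\<Sum>i\<in>(Basis::'a set). s)"
        proof (rule sum_mono)
          fix i :: 'a assume i: "i \<in> Basis"
          have "p \<bullet> i \<le> x \<bullet> i" "x \<bullet> i \<le> q \<bullet> i" "p \<bullet> i \<le> y \<bullet> i" "y \<bullet> i \<le> q \<bullet> i"
            using x y i by (auto simp: pq mem_box)
          then show "\<bar>(y - x) \<bullet> i\<bar> \<le> s" using side[OF i] by (simp add: inner_diff_left)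
        qed
        finally have "norm (y - x) \<le> DIM('a) * s" by simp
        then have "norm (g y - g x) \<le> t"
          using lip[OF y(1) x(1)] L unfolding t_def by (meson mult_left_mono order_trans)
        then have *: "\<bar>(g y - g x) \<bullet> i\<bar> \<le> t" if "i \<in> Basis" for i
          using Basis_le_norm[OF that, of "g y - g x"] by linarith
        show "g y \<in> cbox (g x - t *\<^sub>R One) (g x + t *\<^sub>R One)"
          unfolding mem_box
        proof
          fix i :: 'a assume i: "i \<in> Basis"
          have "(One :: 'a) \<bullet> i = 1"
            using i by simp
          then show "(g x - t *\<^sub>R One) \<bullet> i \<le> g y \<bullet> i \<and> g y \<bullet> i \<le> (g x + t *\<^sub>R One) \<bullet> i"
            using *[OF i] by (simp add: inner_diff_left inner_add_left abs_le_iff)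
        qed
      qed
      then have "emeasure lebesgue (g ` (E \<inter> K)) \<le> emeasure lebesgue (cbox (g x - t *\<^sub>R One) (g x + t *\<^sub>R One))"
        by (intro emeasure_mono) auto
      also have "\<dots> = ennreal (\<Prod>i\<in>(Basis::'a set). 2 * t)"
      proof -
        have "emeasure lborel (cbox (g x - t *\<^sub>R One) (g x + t *\<^sub>R One)) =
            ennreal (\<Prod>i\<in>Basis. ((g x + t *\<^sub>R One) - (g x - t *\<^sub>R One)) \<bullet> i)"
          by (rule emeasure_lborel_cbox)
             (use t in \<open>auto simp: inner_diff_left inner_add_left\<close>)
        also have "(\<Prod>i\<in>Basis. ((g x + t *\<^sub>R One) - (g x - t *\<^sub>R One)) \<bullet> i) = (\<Prod>i\<in>(Basis::'a set). 2 * t)"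
          by (intro prod.cong refl)
             (auto simp: inner_diff_left inner_add_left)
        finally show ?thesis by simp
      qed
      also have "(\<Prod>i\<in>(Basis::'a set). 2 * t) = C * s ^ DIM('a)"
        by (simp add: t_def C_def power_mult_distrib)
      also have "ennreal (C * s ^ DIM('a)) = ennreal C * emeasure lebesgue K"
        using C s by (simp add: eK ennreal_mult)
      finally show ?thesis .
    qed
    show ?thesis
    proof (cases "D = {}")
      case True
      then show ?thesis using D(6) by simp
    next
      case False
      define F where "F = from_nat_into D"
      have F: "range F = D" using False D(1) by (simp add: F_def range_from_nat_into)
      \<comment> \<open>The enumeration \<open>F\<close> of the cubes may repeat values; blanking
        every repetition makes the interiors a disjoint family without changing the union.\<close>
      define G where "G i = (if F i \<in> F ` {..<i} then {} else F i)" for i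
      have GD: "G i = {} \<or> G i \<in> D" for i using F by (auto simp: G_def)
      have UG: "\<Union>(range G) = \<Union>D"
      proof
        show "\<Union>(range G) \<subseteq> \<Union>D" using GD by fastforce
        show "\<Union>D \<subseteq> \<Union>(range G)"
        proof clarify
          fix x K assume x: "x \<in> K" "K \<in> D"
          then obtain i where i: "F i = K" using F by (metis imageE)
          define m where "m = (LEAST i. F i = K)"
          have m: "F m = K" using i unfolding m_def by (rule LeastI)
          have "F j \<noteq> K" if "j < m" for j
            using that not_less_Least unfolding m_def by blast
          then have "F m \<notin> F ` {..<m}" using m by auto
          then show "x \<in> \<Union>(range G)" using m x by (auto simp: G_def intro!: exI[of _ m])
        qed
      qed
      have disj: "disjoint_family (\<lambda>i. interior (G i))"
        unfolding disjoint_family_on_def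
      proof (intro ballI impI)
        fix i j :: nat assume "i \<noteq> j"
        show "interior (G i) \<inter> interior (G j) = {}"
        proof (cases "F i \<in> F ` {..<i} \<or> F j \<in> F ` {..<j}")
          case False
          then have "F i \<noteq> F j" using \<open>i \<noteq> j\<close> by (metis imageI lessThan_iff linorder_neqE_nat)
          then show ?thesis using D(3) F False unfolding pairwise_def G_def by auto
        qed (auto simp: G_def)
      qed
      have Gleb: "G i \<in> sets lebesgue" for i using GD[of i] Kleb by auto
      have subU: "interior (G i) \<subseteq> U" for i
      proof (cases "G i = {}")
        case False
        then obtain x where "x \<in> E" "G i \<subseteq> ball x (d x)" using D(4) GD by blast
        then show ?thesis using d(2) U(2) interior_subset by fast
      qed auto
      have "emeasure lebesgue (g ` E) \<le> emeasure lebesgue (\<Union>i. g ` (E \<inter> G i))"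
      proof (rule emeasure_mono)
        show "g ` E \<subseteq> (\<Union>i. g ` (E \<inter> G i))" using D(6) UG by blast
        show "(\<Union>i. g ` (E \<inter> G i)) \<in> sets lebesgue"
          by (auto intro!: Lipschitz_image_lebesgue[where L=L] lip E Gleb sets.Int)
      qed
      also have "\<dots> \<le> (\<Sum>i. emeasure lebesgue (g ` (E \<inter> G i)))"
        by (rule emeasure_subadditive_countably)
           (auto intro!: Lipschitz_image_lebesgue[where L=L] lip E Gleb sets.Int)
      also have "\<dots> \<le> (\<Sum>i. ennreal C * emeasure lebesgue (interior (G i)))"
      proof (rule suminf_le)
        fix i
        show "emeasure lebesgue (g ` (E \<inter> G i)) \<le> ennreal C * emeasure lebesgue (interior (G i))"
        proof (cases "G i = {}")
          case False
          then have K: "G i \<in> D" using GD by blast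
          then obtain p q where pq: "G i = cbox p q" using D(2) by blast
          \<comment> \<open>The cubes may share faces, so countable additivity is used for their
            interiors, which have the same measure.\<close>
          have "emeasure lebesgue (interior (G i)) = emeasure lebesgue (G i)"
            by (auto simp: pq emeasure_lborel_box_eq emeasure_lborel_cbox_eq interior_cbox)
          then show ?thesis using cube[OF K] by simp
        qed simp
      qed auto
      also have "\<dots> = ennreal C * emeasure lebesgue (\<Union>i. interior (G i))"
        by (subst suminf_emeasure[OF _ disj, symmetric]) auto
      also have "\<dots> \<le> ennreal C * emeasure lebesgue (E \<union> (U - E))"
        by (intro mult_left_mono emeasure_mono) (use subU E U in auto)
      also have "\<dots> \<le> ennreal C * (emeasure lebesgue E + emeasure lebesgue (U - E))"
        by (intro mult_left_mono emeasure_subadditive) (use E U in auto)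
      also have "\<dots> \<le> ennreal C * (emeasure lebesgue E + ennreal e)"
        using U(4) by (intro mult_left_mono add_left_mono) auto
      finally show ?thesis .
    qed
  qed
  show ?thesis
  proof (rule ennreal_le_epsilon)
    fix e :: real assume e: "0 < e"
    \<comment> \<open>Dividing by \<open>C + 1\<close> instead of \<open>C\<close> also covers
      \<open>C = 0\<close>.\<close>
    have "emeasure lebesgue (g ` E) \<le> ennreal C * (emeasure lebesgue E + ennreal (e / (C + 1)))"
      using main C e by simp
    also have "\<dots> = ennreal C * emeasure lebesgue E + ennreal (C * (e / (C + 1)))"
      by (subst ennreal_mult) (use C e in \<open>auto simp: distrib_left\<close>)
    also have "\<dots> \<le> ennreal C * emeasure lebesgue E + ennreal e"
      using C e by (intro add_left_mono ennreal_leI) (simp add: field_simps)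
    finally show "emeasure lebesgue (g ` E) \<le> ennreal ((2 * L * DIM('a)) ^ DIM('a)) * emeasure lebesgue E + ennreal e"
      by (simp add: C_def)
  qed
qed

lemma nn_integral_Lipschitz_inverse:
  fixes f g :: "'a::euclidean_space \<Rightarrow> 'a"
  assumes A: "A \<in> sets lebesgue" and fA: "f ` A \<in> sets lebesgue" "bounded (f ` A)"
    and inv: "\<And>x. x \<in> A \<Longrightarrow> g (f x) = x" and L: "0 \<le> L"
    and lip: "\<And>x y. x \<in> f ` A \<Longrightarrow> y \<in> f ` A \<Longrightarrow> norm (g x - g y) \<le> L * norm (x - y)"
  shows Lipschitz_inverse_measurable: "f \<in> measurable (lebesgue_on A) lebesgue"
    and "\<phi> \<in> borel_measurable lebesgue \<Longrightarrow> B \<in> sets lebesgue \<Longrightarrow> f ` A \<subseteq> B \<Longrightarrow>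
          (\<integral>\<^sup>+x. \<phi> (f x) \<partial>lebesgue_on A) \<le>
            ennreal ((2 * L * DIM('a)) ^ DIM('a)) * (\<integral>\<^sup>+x. \<phi> x \<partial>lebesgue_on B)"
proof -
  have vim: "A \<inter> f -` E = g ` (E \<inter> f ` A)" for E
    using inv by force
  have mvim: "A \<inter> f -` E \<in> sets lebesgue" if "E \<in> sets lebesgue" for E
    unfolding vim by (rule Lipschitz_image_lebesgue[where L=L]) (use that fA lip in auto)
  show meas: "f \<in> measurable (lebesgue_on A) lebesgue"
  proof (rule measurableI)
    fix E :: "'a set" assume "E \<in> sets lebesgue"
    then show "f -` E \<inter> space (lebesgue_on A) \<in> sets (lebesgue_on A)"
      using mvim[of E] A by (simp add: sets_restrict_space_iff Int_commute)
  qed simp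
  define c where "c = ennreal ((2 * L * DIM('a)) ^ DIM('a))"
  assume phi[measurable]: "\<phi> \<in> borel_measurable lebesgue" and B[measurable]: "B \<in> sets lebesgue" and AB: "f ` A \<subseteq> B"
  have "emeasure (distr (lebesgue_on A) lebesgue f) \<le> emeasure (scale_measure c lebesgue)"
  proof (rule le_funI)
    fix E
    show "emeasure (distr (lebesgue_on A) lebesgue f) E \<le> emeasure (scale_measure c lebesgue) E"
    proof (cases "E \<in> sets lebesgue")
      case True
      have "emeasure (distr (lebesgue_on A) lebesgue f) E = emeasure lebesgue (A \<inter> f -` E)"
        using True A by (simp add: emeasure_distr[OF meas] emeasure_restrict_space Int_commute)
      also have "\<dots> \<le> c * emeasure lebesgue (E \<inter> f ` A)"
        unfolding vim c_def
        by (rule emeasure_Lipschitz_image_le) (use True fA lip L in \<open>auto intro: bounded_subset\<close>)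
      also have "\<dots> \<le> c * emeasure lebesgue E"
        using True by (intro mult_left_mono emeasure_mono) auto
      finally show ?thesis by simp
    qed (simp add: emeasure_notin_sets)
  qed
  then have le: "distr (lebesgue_on A) lebesgue f \<le> scale_measure c lebesgue"
    by (subst le_measure) (simp_all only: le_fun_def sets_distr sets_scale_measure ball_simps, blast)
  have "(\<integral>\<^sup>+x. \<phi> (f x) \<partial>lebesgue_on A) = (\<integral>\<^sup>+x. \<phi> (f x) * indicator B (f x) \<partial>lebesgue_on A)"
    using AB by (intro nn_integral_cong) (auto split: split_indicator)
  also have "\<dots> = (\<integral>\<^sup>+x. \<phi> x * indicator B x \<partial>distr (lebesgue_on A) lebesgue f)"
    by (rule nn_integral_distr[symmetric, OF meas]) simp
  also have "\<dots> \<le> (\<integral>\<^sup>+x. \<phi> x * indicator B x \<partial>scale_measure c lebesgue)"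
    by (rule nn_integral_mono_measure[OF _ le]) simp
  also have "\<dots> = c * (\<integral>\<^sup>+x\<in>B. \<phi> x \<partial>lebesgue)"
    by (rule nn_integral_scale_measure) simp
  also have "(\<integral>\<^sup>+x\<in>B. \<phi> x \<partial>lebesgue) = (\<integral>\<^sup>+x. \<phi> x \<partial>lebesgue_on B)"
    by (subst nn_integral_restrict_space) auto
  finally show "(\<integral>\<^sup>+x. \<phi> (f x) \<partial>lebesgue_on A) \<le>
            ennreal ((2 * L * DIM('a)) ^ DIM('a)) * (\<integral>\<^sup>+x. \<phi> x \<partial>lebesgue_on B)"
    by (simp add: c_def)
qed

section \<open>Radial power maps\<close>

text \<open>The value at the origin is 0 for every exponent, which lets the norm and inverse
  identities hold there as well, even for negative \<open>\<beta>\<close>. The case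
  \<open>\<beta> = -1\<close> is the inversion in the unit sphere.\<close>

definition radial_power :: "real \<Rightarrow> 'a::real_normed_vector \<Rightarrow> 'a" where
  "radial_power \<beta> z = (norm z powr (\<beta> - 1)) *\<^sub>R z"

lemma norm_radial_power: "norm (radial_power \<beta> z) = norm z powr \<beta>"
proof (cases "z = 0")
  case False
  have "norm z powr \<beta> = norm z powr ((\<beta> - 1) + 1)" by simp
  also have "\<dots> = norm z powr (\<beta> - 1) * norm z" unfolding powr_add using False by simp
  finally show ?thesis by (simp add: radial_power_def)
qed (simp add: radial_power_def)

lemma radial_power_inverse:
  assumes "\<beta> \<noteq> 0" shows "radial_power (1 / \<beta>) (radial_power \<beta> z) = z"
proof (cases "z = 0")
  case False
  have "(norm z powr \<beta>) powr (1 / \<beta> - 1) * norm z powr (\<beta> - 1) = norm z powr 0"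
    using assms unfolding powr_powr powr_add[symmetric] by (simp add: field_simps)
  then show ?thesis
    using False by (simp add: radial_power_def[of "1/\<beta>"] norm_radial_power) (simp add: radial_power_def)
qed (simp add: radial_power_def)

definition shell :: "real \<Rightarrow> real \<Rightarrow> 'a::real_normed_vector set" where
  "shell q \<sigma> = {x. \<sigma> / q \<le> norm x \<and> norm x \<le> q * \<sigma>}"

text \<open>A power is monotone, so the extreme value sits at the right end for
  \<open>p \<ge> 0\<close> and at the left end otherwise; since the interval is multiplicatively
  symmetric about \<open>\<sigma>\<close>, both ends give the same factor.\<close>

lemma powr_le_on_shell:
  fixes t q \<sigma> p :: real
  assumes q: "1 \<le> q" and s: "0 < \<sigma>" and t: "\<sigma> / q \<le> t" "t \<le> q * \<sigma>"
  shows "t powr p \<le> q powr \<bar>p\<bar> * \<sigma> powr p"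
proof (cases "p \<ge> 0")
  case True
  have "0 \<le> t" using t q s by (smt (verit) divide_pos_pos)
  then have "t powr p \<le> (q * \<sigma>) powr p" using t True by (intro powr_mono2) auto
  then show ?thesis using True q s by (simp add: powr_mult)
next
  case False
  have "t powr p \<le> (\<sigma> / q) powr p" using t False q s by (intro powr_mono2') auto
  also have "\<dots> = q powr \<bar>p\<bar> * \<sigma> powr p"
    using False q s by (simp add: powr_divide powr_minus_divide)
  finally show ?thesis .
qed

lemma powr_Lipschitz_on_shell:
  fixes a b q \<sigma> p :: real
  assumes q: "1 \<le> q" and s: "0 < \<sigma>" and a: "\<sigma> / q \<le> a" "a \<le> q * \<sigma>" and b: "\<sigma> / q \<le> b" "b \<le> q * \<sigma>"
  shows "\<bar>a powr p - b powr p\<bar> \<le> \<bar>p\<bar> * (q powr \<bar>p - 1\<bar> * \<sigma> powr (p - 1)) * \<bar>a - b\<bar>"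
proof -
  have pos: "0 < \<sigma> / q" using q s by simp
  have "norm (a powr p - b powr p) \<le> \<bar>p\<bar> * (q powr \<bar>p - 1\<bar> * \<sigma> powr (p - 1)) * norm (a - b)"
  proof (rule field_differentiable_bound[of "{\<sigma> / q..q * \<sigma>}" "\<lambda>t. t powr p" "\<lambda>t. p * t powr (p - 1)"])
    fix z assume z: "z \<in> {\<sigma> / q..q * \<sigma>}"
    show "((\<lambda>t. t powr p) has_field_derivative p * z powr (p - 1)) (at z within {\<sigma> / q..q * \<sigma>})"
      using z pos by (auto intro!: derivative_eq_intros)
    show "norm (p * z powr (p - 1)) \<le> \<bar>p\<bar> * (q powr \<bar>p - 1\<bar> * \<sigma> powr (p - 1))"
      using powr_le_on_shell[OF q s, of z "p - 1"] z by (simp add: abs_mult mult_left_mono)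
  qed (use a b in auto)
  then show ?thesis by simp
qed

text \<open>A Lipschitz constant at scale \<open>\<sigma> = 1\<close>. The first summand bounds the
  scalar factor, the second comes from the variation of that factor, multiplied by the largest norm
  \<open>q\<close> in the shell.\<close>

definition radial_Lip :: "real \<Rightarrow> real \<Rightarrow> real" where
  "radial_Lip \<beta> q = q powr \<bar>\<beta> - 1\<bar> + \<bar>\<beta> - 1\<bar> * q powr \<bar>\<beta> - 2\<bar> * q"

lemma radial_Lip_pos: "1 \<le> q \<Longrightarrow> 0 < radial_Lip \<beta> q"
  unfolding radial_Lip_def by (intro add_pos_nonneg) auto

lemma radial_power_Lipschitz:
  assumes q: "1 \<le> q" and s: "0 < \<sigma>" and x: "x \<in> shell q \<sigma>" and y: "y \<in> shell q \<sigma>"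
  shows "norm (radial_power \<beta> x - radial_power \<beta> y) \<le> radial_Lip \<beta> q * \<sigma> powr (\<beta> - 1) * norm (x - y)"
proof -
  have x': "\<sigma> / q \<le> norm x" "norm x \<le> q * \<sigma>" and y': "\<sigma> / q \<le> norm y" "norm y \<le> q * \<sigma>"
    using x y by (auto simp: shell_def)
  \<comment> \<open>The shell is not convex, so the mean value theorem is not applied along the
    segment from \<open>x\<close> to \<open>y\<close>. Splitting off the scalar factor reduces it to
    the interval of norms.\<close>
  have "radial_power \<beta> x - radial_power \<beta> y =
      (norm x powr (\<beta> - 1)) *\<^sub>R (x - y) + (norm x powr (\<beta> - 1) - norm y powr (\<beta> - 1)) *\<^sub>R y"
    by (simp add: radial_power_def algebra_simps)
  also have "norm \<dots> \<le> norm x powr (\<beta> - 1) * norm (x - y) + \<bar>norm x powr (\<beta> - 1) - norm y powr (\<beta> - 1)\<bar> * norm y"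
    by (rule order_trans[OF norm_triangle_ineq]) simp
  also have "norm x powr (\<beta> - 1) * norm (x - y) \<le> (q powr \<bar>\<beta> - 1\<bar> * \<sigma> powr (\<beta> - 1)) * norm (x - y)"
    using powr_le_on_shell[OF q s x'] by (intro mult_right_mono) auto
  also have "\<bar>norm x powr (\<beta> - 1) - norm y powr (\<beta> - 1)\<bar> * norm y
      \<le> (\<bar>\<beta> - 1\<bar> * (q powr \<bar>\<beta> - 2\<bar> * \<sigma> powr (\<beta> - 2)) * norm (x - y)) * (q * \<sigma>)"
  proof (rule mult_mono)
    have "\<bar>norm x powr (\<beta> - 1) - norm y powr (\<beta> - 1)\<bar> \<le>
        \<bar>\<beta> - 1\<bar> * (q powr \<bar>\<beta> - 1 - 1\<bar> * \<sigma> powr (\<beta> - 1 - 1)) * \<bar>norm x - norm y\<bar>"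
      by (rule powr_Lipschitz_on_shell[OF q s x' y'])
    also have "\<dots> \<le> \<bar>\<beta> - 1\<bar> * (q powr \<bar>\<beta> - 1 - 1\<bar> * \<sigma> powr (\<beta> - 1 - 1)) * norm (x - y)"
      by (intro mult_left_mono norm_triangle_ineq3) auto
    finally show "\<bar>norm x powr (\<beta> - 1) - norm y powr (\<beta> - 1)\<bar> \<le>
        \<bar>\<beta> - 1\<bar> * (q powr \<bar>\<beta> - 2\<bar> * \<sigma> powr (\<beta> - 2)) * norm (x - y)" by simp
  qed (use y' q s in auto)
  also have "(q powr \<bar>\<beta> - 1\<bar> * \<sigma> powr (\<beta> - 1)) * norm (x - y) +
      (\<bar>\<beta> - 1\<bar> * (q powr \<bar>\<beta> - 2\<bar> * \<sigma> powr (\<beta> - 2)) * norm (x - y)) * (q * \<sigma>) =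
      radial_Lip \<beta> q * \<sigma> powr (\<beta> - 1) * norm (x - y)"
  proof -
    have "\<sigma> powr (\<beta> - 1) = \<sigma> powr (\<beta> - 2) * \<sigma> powr 1" unfolding powr_add[symmetric] by simp
    then have "\<sigma> powr (\<beta> - 1) = \<sigma> powr (\<beta> - 2) * \<sigma>" using s by simp
    then show ?thesis by (simp add: radial_Lip_def algebra_simps)
  qed
  finally show ?thesis by simp
qed

lemma radial_power_shell:
  assumes q: "1 \<le> q" and s: "0 < \<sigma>" and x: "x \<in> shell q \<sigma>"
  shows "radial_power \<beta> x \<in> shell (q powr \<bar>\<beta>\<bar>) (\<sigma> powr \<beta>)"
proof -
  have x': "\<sigma> / q \<le> norm x" "norm x \<le> q * \<sigma>" and "0 < \<sigma> / q" using x q s by (auto simp: shell_def)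
  then have pos: "0 < norm x" by linarith
  \<comment> \<open>The lower bound on the image norm is the upper bound for the opposite exponent,
    inverted.\<close>
  have "norm x powr (- \<beta>) \<le> q powr \<bar>- \<beta>\<bar> * \<sigma> powr (- \<beta>)" by (rule powr_le_on_shell[OF q s x'])
  then have "\<sigma> powr \<beta> \<le> q powr \<bar>\<beta>\<bar> * norm x powr \<beta>"
    using s pos by (simp add: powr_minus field_simps)
  moreover have "norm x powr \<beta> \<le> q powr \<bar>\<beta>\<bar> * \<sigma> powr \<beta>" by (rule powr_le_on_shell[OF q s x'])
  ultimately show ?thesis using q by (simp add: shell_def norm_radial_power field_simps)
qed

lemma closed_shell: "closed (shell q \<sigma>)"
  unfolding shell_def by (intro closed_Collect_conj closed_Collect_le continuous_intros)

lemma bounded_shell: "bounded (shell q \<sigma>)"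
  by (rule boundedI[of _ "q * \<sigma>"]) (simp add: shell_def)

text \<open>The map \<open>radial_power \<beta>\<close> has the inverse \<open>radial_power (1 / \<beta>)\<close>, whose Lipschitz constant on
  the image of the shell is comparable to \<open>\<sigma> powr (1 - \<beta>)\<close>.\<close>
definition radial_vol :: "real \<Rightarrow> real \<Rightarrow> real" where
  "radial_vol \<beta> q = radial_Lip (1 / \<beta>) (q powr \<bar>\<beta>\<bar>)"

lemma radial_vol_pos: "1 \<le> q \<Longrightarrow> 0 < radial_vol \<beta> q"
  unfolding radial_vol_def by (intro radial_Lip_pos ge_one_powr_ge_zero) auto

lemma
  fixes A :: "'a::euclidean_space set"
  assumes \<beta>: "\<beta> \<noteq> 0" and q: "1 \<le> q" and s: "0 < \<sigma>" and A: "A \<in> sets lebesgue" "A \<subseteq> shell q \<sigma>"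
  shows radial_power_measurable_shell: "radial_power \<beta> \<in> measurable (lebesgue_on A) lebesgue"
    and nn_integral_radial_power: "\<phi> \<in> borel_measurable lebesgue \<Longrightarrow> B \<in> sets lebesgue \<Longrightarrow> radial_power \<beta> ` A \<subseteq> B \<Longrightarrow>
          (\<integral>\<^sup>+x. \<phi> (radial_power \<beta> x) \<partial>lebesgue_on A) \<le>
            ennreal ((2 * (radial_vol \<beta> q * \<sigma> powr (1 - \<beta>)) * DIM('a)) ^ DIM('a)) * (\<integral>\<^sup>+x. \<phi> x \<partial>lebesgue_on B)"
proof -
  have fA: "radial_power \<beta> ` A \<in> sets lebesgue"
    using radial_power_Lipschitz[OF q s] A by (intro Lipschitz_image_lebesgue) blast+
  have fA': "radial_power \<beta> ` A \<subseteq> shell (q powr \<bar>\<beta>\<bar>) (\<sigma> powr \<beta>)"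
    using radial_power_shell[OF q s] A by blast
  have bdd: "bounded (radial_power \<beta> ` A)" using bounded_shell fA' bounded_subset by blast
  have q': "1 \<le> q powr \<bar>\<beta>\<bar>" using q by (intro ge_one_powr_ge_zero) auto
  \<comment> \<open>The image shell has scale \<open>\<sigma> powr \<beta>\<close>; the inverse map
    has exponent \<open>1 / \<beta>\<close>, and the product of the exponents is
    \<open>1 - \<beta>\<close>.\<close>
  have eq: "radial_Lip (1 / \<beta>) (q powr \<bar>\<beta>\<bar>) * (\<sigma> powr \<beta>) powr (1 / \<beta> - 1) = radial_vol \<beta> q * \<sigma> powr (1 - \<beta>)"
    using \<beta> by (simp add: radial_vol_def powr_powr algebra_simps)
  have lip: "norm (radial_power (1 / \<beta>) x - radial_power (1 / \<beta>) y) \<le> (radial_vol \<beta> q * \<sigma> powr (1 - \<beta>)) * norm (x - y)"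
    if "x \<in> radial_power \<beta> ` A" "y \<in> radial_power \<beta> ` A" for x y
    unfolding eq[symmetric] by (rule radial_power_Lipschitz[OF q']) (use s that fA' in auto)
  have nonneg: "0 \<le> radial_vol \<beta> q * \<sigma> powr (1 - \<beta>)" using radial_vol_pos[OF q, of \<beta>] by simp
  note * = A(1) fA bdd radial_power_inverse[OF \<beta>] nonneg lip
  show "radial_power \<beta> \<in> measurable (lebesgue_on A) lebesgue"
    by (rule Lipschitz_inverse_measurable[OF *])
  show "(\<integral>\<^sup>+x. \<phi> (radial_power \<beta> x) \<partial>lebesgue_on A) \<le>
            ennreal ((2 * (radial_vol \<beta> q * \<sigma> powr (1 - \<beta>)) * DIM('a)) ^ DIM('a)) * (\<integral>\<^sup>+x. \<phi> x \<partial>lebesgue_on B)"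
    if "\<phi> \<in> borel_measurable lebesgue" "B \<in> sets lebesgue" "radial_power \<beta> ` A \<subseteq> B"
    by (rule nn_integral_Lipschitz_inverse(2)[OF * that])
qed

text \<open>Continuity off the origin gives only Borel preimages; preimages of Lebesgue null sets
  must also be measurable. This is known on each shell, and countably many shells around scale 1
  exhaust the punctured space.\<close>

lemma radial_power_measurable:
  assumes \<beta>: "\<beta> \<noteq> 0"
  shows "(radial_power \<beta> :: 'a::euclidean_space \<Rightarrow> 'a) \<in> measurable lebesgue lebesgue"
proof (rule measurableI)
  fix E :: "'a set" assume E: "E \<in> sets lebesgue"
  let ?f = "radial_power \<beta> :: 'a \<Rightarrow> 'a"
  have m: "?f -` E \<inter> shell (real (Suc k)) 1 \<in> sets lebesgue" for k
  proof -
    have S: "shell (real (Suc k)) 1 \<in> sets (lebesgue :: 'a measure)"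
      by (rule sets_completionI_sets) (simp add: borel_closed closed_shell)
    have "?f -` E \<inter> space (lebesgue_on (shell (real (Suc k)) 1)) \<in> sets (lebesgue_on (shell (real (Suc k)) 1))"
      by (rule measurable_sets[OF radial_power_measurable_shell[OF \<beta> _ _ S order_refl] E]) auto
    then show ?thesis using S by (simp add: sets_restrict_space_iff)
  qed
  have cover: "\<exists>k. x \<in> shell (real (Suc k)) 1" if "x \<noteq> 0" for x :: 'a
  proof -
    obtain k where k: "real k \<ge> max (norm x) (1 / norm x)" using real_arch_simple by blast
    then have "norm x \<le> real (Suc k)" "1 / norm x \<le> real (Suc k)" by auto
    then have "x \<in> shell (real (Suc k)) 1" using that by (simp add: shell_def field_simps)
    then show ?thesis ..
  qed
  have "?f -` E = (?f -` E \<inter> {0}) \<union> (\<Union>k. ?f -` E \<inter> shell (real (Suc k)) 1)"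
    using cover by blast
  also have "\<dots> \<in> sets lebesgue"
  proof (rule sets.Un)
    show "?f -` E \<inter> {0} \<in> sets lebesgue" by (cases "0 \<in> ?f -` E") auto
    show "(\<Union>k. ?f -` E \<inter> shell (real (Suc k)) 1) \<in> sets lebesgue"
      using m by (intro sets.countable_nat_UN) blast
  qed
  finally show "?f -` E \<inter> space lebesgue \<in> sets lebesgue" by simp
qed simp

section \<open>Double integrals over sets\<close>

lemma sigma_finite_lebesgue_on:
  assumes "A \<in> sets lebesgue"
  shows "sigma_finite_measure (lebesgue_on A :: 'a::euclidean_space measure)"
proof -
  have "sigma_finite_measure (lebesgue :: 'a measure)"
  proof
    show "\<exists>A. countable A \<and> A \<subseteq> sets lebesgue \<and> \<Union>A = space (lebesgue :: 'a measure) \<and>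
          (\<forall>a\<in>A. emeasure lebesgue a \<noteq> \<infinity>)"
    proof (intro exI[of _ "range (\<lambda>n. ball (0::'a) (real n))"] conjI ballI)
      show "\<Union>(range (\<lambda>n. ball (0::'a) (real n))) = space lebesgue"
        using reals_Archimedean2 by fastforce
      fix B assume "B \<in> range (\<lambda>n. ball (0::'a) (real n))"
      then show "emeasure lebesgue B \<noteq> \<infinity>"
        using fmeasurableD2[OF lmeasurable_ball[of "0 :: 'a"]] by auto
    qed auto
  qed
  then show ?thesis
    using assms by (rule sigma_finite_measure_restrict_space)
qed

text \<open>The first set carries the outer variable, which is the second argument of
  \<open>K\<close>. This is the order of integration in \<open>Q_norm\<close>.\<close>

definition double_integral ::
    "('a::euclidean_space \<Rightarrow> 'a \<Rightarrow> ennreal) \<Rightarrow> 'a set \<Rightarrow> 'a set \<Rightarrow> ennreal" where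
  "double_integral K A B = (\<integral>\<^sup>+y. (\<integral>\<^sup>+x. K x y \<partial>lebesgue_on B) \<partial>lebesgue_on A)"

text \<open>Measurability refers to the product of the two completed sigma-algebras, not to its
  completion, so every section is measurable and Tonelli's theorem applies directly.\<close>

definition leb_kernel :: "('a::euclidean_space \<Rightarrow> 'a \<Rightarrow> ennreal) \<Rightarrow> bool" where
  "leb_kernel K \<longleftrightarrow> (\<lambda>(x, y). K x y) \<in> borel_measurable (lebesgue \<Otimes>\<^sub>M lebesgue)"

lemma leb_kernel_restrict:
  assumes "leb_kernel K"
  shows "(\<lambda>(x, y). K x y) \<in> borel_measurable (lebesgue_on A \<Otimes>\<^sub>M lebesgue_on B)"
proof -
  have "(\<lambda>z. (fst z, snd z)) \<in> (lebesgue_on A \<Otimes>\<^sub>M lebesgue_on B) \<rightarrow>\<^sub>M (lebesgue \<Otimes>\<^sub>M lebesgue)"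
    by (intro measurable_Pair measurable_compose[OF measurable_fst] measurable_compose[OF measurable_snd]
        measurable_restrict_space1 measurable_ident_sets) auto
  from measurable_compose[OF this assms[unfolded leb_kernel_def]] show ?thesis
    by (simp add: case_prod_beta)
qed

lemma leb_kernel_swap:
  assumes "leb_kernel K" shows "leb_kernel (\<lambda>x y. K y x)"
  using measurable_compose[OF measurable_pair_swap' assms[unfolded leb_kernel_def]]
  unfolding leb_kernel_def by (simp add: case_prod_beta)

lemma leb_kernel_section:
  assumes "leb_kernel K" shows "(\<lambda>x. K x y) \<in> borel_measurable (lebesgue_on A)"
proof -
  have "(\<lambda>x. (x, y)) \<in> lebesgue_on A \<rightarrow>\<^sub>M (lebesgue \<Otimes>\<^sub>M lebesgue)"
    by (intro measurable_Pair measurable_restrict_space1 measurable_ident_sets) auto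
  from measurable_compose[OF this assms[unfolded leb_kernel_def]] show ?thesis by simp
qed

lemma leb_kernel_inner:
  assumes "leb_kernel K" and B: "B \<in> sets lebesgue"
  shows "(\<lambda>y. \<integral>\<^sup>+x. K x y \<partial>lebesgue_on B) \<in> borel_measurable (lebesgue_on A)"
proof -
  interpret sigma_finite_measure "lebesgue_on B" by (rule sigma_finite_lebesgue_on[OF B])
  show ?thesis
    using leb_kernel_restrict[OF leb_kernel_swap[OF assms(1)], of A B] by measurable
qed

lemma leb_kernel_inner_lebesgue:
  assumes "leb_kernel K" and B: "B \<in> sets lebesgue"
  shows "(\<lambda>y. \<integral>\<^sup>+x. K x y \<partial>lebesgue_on B) \<in> borel_measurable lebesgue"
  using leb_kernel_inner[OF assms, of UNIV] by (simp add: lebesgue_on_UNIV_eq)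

lemma double_integral_swap:
  assumes "leb_kernel K" and A: "A \<in> sets lebesgue" and B: "B \<in> sets lebesgue"
  shows "double_integral K A B = double_integral (\<lambda>x y. K y x) B A"
proof -
  interpret pair_sigma_finite "lebesgue_on B" "lebesgue_on A"
    by (intro pair_sigma_finite.intro sigma_finite_lebesgue_on A B)
  show ?thesis
    unfolding double_integral_def
    by (rule Fubini'[of K]) (rule leb_kernel_restrict[OF assms(1)])
qed

lemma double_integral_mono:
  assumes "\<And>x y. y \<in> A \<Longrightarrow> x \<in> B \<Longrightarrow> K x y \<le> K' x y"
  shows "double_integral K A B \<le> double_integral K' A B"
  unfolding double_integral_def
  by (intro nn_integral_mono) (use assms in \<open>auto simp: space_restrict_space\<close>)

lemma double_integral_cmult:
  assumes "leb_kernel K" "B \<in> sets lebesgue"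
  shows "double_integral (\<lambda>x y. c * K x y) A B = c * double_integral K A B"
  unfolding double_integral_def
  by (simp add: nn_integral_cmult leb_kernel_section leb_kernel_inner assms)

lemma nn_integral_lebesgue_on_subset:
  assumes "A \<subseteq> A'" "A \<in> sets lebesgue" "A' \<in> sets lebesgue"
  shows "nn_integral (lebesgue_on A) \<phi> \<le> nn_integral (lebesgue_on A') \<phi>"
  using assms
  by (subst (1 2) nn_integral_restrict_space) (auto intro!: nn_integral_mono split: split_indicator)

lemma double_integral_subset:
  assumes "A \<subseteq> A'" "B \<subseteq> B'" "A \<in> sets lebesgue" "A' \<in> sets lebesgue" "B \<in> sets lebesgue" "B' \<in> sets lebesgue"
  shows "double_integral K A B \<le> double_integral K A' B'"
proof -
  have "double_integral K A B \<le> double_integral K A B'"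
    unfolding double_integral_def
    by (intro nn_integral_mono nn_integral_lebesgue_on_subset[OF assms(2,5,6)])
  also have "\<dots> \<le> double_integral K A' B'"
    unfolding double_integral_def by (rule nn_integral_lebesgue_on_subset[OF assms(1,3,4)])
  finally show ?thesis .
qed

section \<open>Fractional energies under the radial map\<close>

definition frac_kernel :: "real \<Rightarrow> ('a::euclidean_space \<Rightarrow> real) \<Rightarrow> 'a \<Rightarrow> 'a \<Rightarrow> ennreal" where
  "frac_kernel p u x y = ennreal (\<bar>u x - u y\<bar>\<^sup>2 / norm (x - y) powr p)"

definition sq_kernel :: "('a \<Rightarrow> real) \<Rightarrow> 'a \<Rightarrow> 'a \<Rightarrow> ennreal" where
  "sq_kernel u x y = ennreal (\<bar>u x - u y\<bar>\<^sup>2)"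

lemma leb_kernel_sq_kernel:
  assumes [measurable]: "u \<in> borel_measurable lebesgue"
  shows "leb_kernel (sq_kernel u)"
  unfolding leb_kernel_def sq_kernel_def by measurable

lemma leb_kernel_frac_kernel:
  assumes [measurable]: "u \<in> borel_measurable lebesgue"
  shows "leb_kernel (frac_kernel p u)"
proof -
  have [measurable]: "(\<lambda>x::'a. x) \<in> borel_measurable lebesgue"
    by (intro measurable_completion) simp
  show ?thesis unfolding leb_kernel_def frac_kernel_def by measurable
qed

lemma frac_kernel_commute: "frac_kernel p u x y = frac_kernel p u y x"
  by (simp add: frac_kernel_def abs_minus_commute norm_minus_commute)

lemma double_integral_frac_kernel_commute:
  assumes "u \<in> borel_measurable lebesgue" "A \<in> sets lebesgue" "B \<in> sets lebesgue"
  shows "double_integral (frac_kernel p u) A B = double_integral (frac_kernel p u) B A"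
proof -
  have "(\<lambda>x y. frac_kernel p u y x) = frac_kernel p u"
    by (intro ext) (rule frac_kernel_commute)
  then show ?thesis
    using double_integral_swap[OF leb_kernel_frac_kernel[OF assms(1)] assms(2,3), of p] by simp
qed

lemma frac_kernel_comp_le:
  assumes p: "0 \<le> p" and L: "0 \<le> L" and lip: "norm (f x - f y) \<le> L * norm (x - y)"
  shows "frac_kernel p (u \<circ> f) x y \<le> ennreal (L powr p) * frac_kernel p u (f x) (f y)"
\<comment> \<open>When \<open>f x = f y\<close> the numerator on the left vanishes, so the bound is
  trivial; otherwise both distances are positive and may be divided by.\<close>
proof (cases "f x = f y")
  case False
  then have pos: "0 < norm (f x - f y)" and xy: "0 < norm (x - y)" by auto
  have "norm (f x - f y) powr p \<le> (L * norm (x - y)) powr p"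
    using lip p by (intro powr_mono2) auto
  then have le: "norm (f x - f y) powr p \<le> L powr p * norm (x - y) powr p"
    using L by (simp add: powr_mult)
  have "\<bar>u (f x) - u (f y)\<bar>\<^sup>2 / norm (x - y) powr p
      \<le> L powr p * (\<bar>u (f x) - u (f y)\<bar>\<^sup>2 / norm (f x - f y) powr p)"
    using mult_left_mono[OF le, of "\<bar>u (f x) - u (f y)\<bar>\<^sup>2"] pos xy
    by (simp add: field_simps)
  then show ?thesis
    by (simp add: frac_kernel_def ennreal_leI flip: ennreal_mult)
qed (simp add: frac_kernel_def)

text \<open>The one-sided change of variables is applied once in each variable, whence the power
  \<open>2 * DIM('a)\<close> of the volume factor.\<close>

lemma double_integral_radial_power:
  fixes A :: "'a::euclidean_space set"
  assumes \<beta>: "\<beta> \<noteq> 0" and q: "1 \<le> q" and s: "0 < \<sigma>" and A: "A \<in> sets lebesgue" "A \<subseteq> shell q \<sigma>"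
    and K: "leb_kernel K" and B: "B \<in> sets lebesgue" "radial_power \<beta> ` A \<subseteq> B"
  shows "double_integral (\<lambda>x y. K (radial_power \<beta> x) (radial_power \<beta> y)) A A
     \<le> ennreal ((2 * (radial_vol \<beta> q * \<sigma> powr (1 - \<beta>)) * DIM('a)) ^ (2 * DIM('a))) * double_integral K B B"
proof -
  let ?f = "radial_power \<beta> :: 'a \<Rightarrow> 'a"
  define c where "c = ennreal ((2 * (radial_vol \<beta> q * \<sigma> powr (1 - \<beta>)) * DIM('a)) ^ DIM('a))"
  note cov = nn_integral_radial_power[OF \<beta> q s A _ B, folded c_def]
  have sec: "(\<lambda>x. K x y) \<in> borel_measurable lebesgue" for y
    using leb_kernel_section[OF K, of y UNIV] by (simp add: lebesgue_on_UNIV_eq)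
  have "double_integral (\<lambda>x y. K (?f x) (?f y)) A A
      \<le> (\<integral>\<^sup>+y. c * (\<integral>\<^sup>+x. K x (?f y) \<partial>lebesgue_on B) \<partial>lebesgue_on A)"
    unfolding double_integral_def by (intro nn_integral_mono cov sec)
  also have "\<dots> \<le> c * (\<integral>\<^sup>+y. c * (\<integral>\<^sup>+x. K x y \<partial>lebesgue_on B) \<partial>lebesgue_on B)"
    by (rule cov[of "\<lambda>y. c * (\<integral>\<^sup>+x. K x y \<partial>lebesgue_on B)"])
       (use leb_kernel_inner_lebesgue[OF K B(1)] in measurable)
  also have "\<dots> = c * (c * double_integral K B B)"
    unfolding double_integral_def by (simp add: nn_integral_cmult leb_kernel_inner K B)
  also have "\<dots> = (c * c) * double_integral K B B" by (simp add: mult.assoc)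
  also have "c * c = ennreal ((2 * (radial_vol \<beta> q * \<sigma> powr (1 - \<beta>)) * DIM('a)) ^ (2 * DIM('a)))"
    unfolding c_def mult_2[of "DIM('a)"] power_add
    by (rule ennreal_mult[symmetric]) (use radial_vol_pos[OF q, of \<beta>] in simp_all)
  finally show ?thesis .
qed

text \<open>For \<open>M \<ge> 0\<close> this bounds the squared Q norm by \<open>M\<close>, with
  the power of the radius moved to the right so that neither a supremum nor a root appears in the
  estimates.\<close>

definition energy_le :: "real \<Rightarrow> real \<Rightarrow> ('a::euclidean_space \<Rightarrow> real) \<Rightarrow> bool" where
  "energy_le \<alpha> M u \<longleftrightarrow> (\<forall>x r. 0 < r \<longrightarrow>
    double_integral (frac_kernel (real DIM('a) + 2 * \<alpha>) u) (ball x r) (ball x r)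
      \<le> ennreal (M * r powr (real DIM('a) - 2 * \<alpha>)))"

lemma energy_leD:
  fixes u :: "'a::euclidean_space \<Rightarrow> real"
  assumes "energy_le \<alpha> M u" "0 < r"
  shows "double_integral (frac_kernel (real DIM('a) + 2 * \<alpha>) u) (ball x r) (ball x r)
      \<le> ennreal (M * r powr (real DIM('a) - 2 * \<alpha>))"
  using assms by (simp add: energy_le_def)

text \<open>On a shell \<open>radial_power \<beta>\<close> is bi-Lipschitz up to scaling by \<open>\<sigma> powr (\<beta> - 1)\<close>, and the exponents in
  the energy bound are such that the scale \<open>\<sigma>\<close> cancels.\<close>
lemma frac_energy_radial_power_shell:
  fixes \<alpha> \<beta> q :: real
  assumes \<beta>: "\<beta> \<noteq> 0" and q: "1 \<le> q" and \<alpha>: "0 \<le> \<alpha>"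
  obtains C where "0 < C"
    "\<And>(u :: 'a::euclidean_space \<Rightarrow> real) M \<sigma> A x0 r.
      u \<in> borel_measurable lebesgue \<Longrightarrow> 0 \<le> M \<Longrightarrow>
      energy_le \<alpha> M u \<Longrightarrow>
      0 < \<sigma> \<Longrightarrow> A \<in> sets lebesgue \<Longrightarrow> A \<subseteq> shell q \<sigma> \<Longrightarrow> (x0 :: 'a) \<in> shell q \<sigma> \<Longrightarrow> 0 < r \<Longrightarrow> A \<subseteq> ball x0 r \<Longrightarrow>
      double_integral (frac_kernel (real DIM('a) + 2 * \<alpha>) (u \<circ> radial_power \<beta>)) A A
          \<le> ennreal (C * M * r powr (real DIM('a) - 2 * \<alpha>))"
proof -
  define d where "d = real DIM('a)"
  define l where "l = radial_Lip \<beta> q"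
  define v where "v = 2 * radial_vol \<beta> q * d"
  have d: "0 < d" and l: "0 < l" and v: "0 < v"
    using radial_Lip_pos[OF q] radial_vol_pos[OF q] by (simp_all add: d_def l_def v_def)
  \<comment> \<open>The three factors stem from comparing the kernels, from changing both variables,
    and from the radius \<open>L * r\<close> of the ball around the image of the centre.\<close>
  define C where "C = l powr (d + 2 * \<alpha>) * v powr (2 * d) * l powr (d - 2 * \<alpha>)"
  show thesis
  proof (rule that)
    show "0 < C" using l v by (simp add: C_def)
    fix u :: "'a \<Rightarrow> real" and M \<sigma> :: real and A and x0 :: 'a and r
    assume u: "u \<in> borel_measurable lebesgue" and M: "0 \<le> M"
      and bd: "energy_le \<alpha> M u"
      and s: "0 < \<sigma>" and A: "A \<in> sets lebesgue" "A \<subseteq> shell q \<sigma>" and x0: "x0 \<in> shell q \<sigma>"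
      and r: "0 < r" and Ar: "A \<subseteq> ball x0 r"
    let ?f = "radial_power \<beta> :: 'a \<Rightarrow> 'a"
    define L where "L = l * \<sigma> powr (\<beta> - 1)"
    have L: "0 < L" using l s by (simp add: L_def)
    define B where "B = ball (?f x0) (L * r)"
    have lip: "norm (?f x - ?f y) \<le> L * norm (x - y)" if "x \<in> shell q \<sigma>" "y \<in> shell q \<sigma>" for x y
      unfolding L_def l_def by (rule radial_power_Lipschitz[OF q s that])
    have fAB: "?f ` A \<subseteq> B"
    proof clarify
      fix x assume x: "x \<in> A"
      have "norm (?f x0 - ?f x) \<le> L * norm (x0 - x)" using lip x0 x A by blast
      also have "\<dots> < L * r" using x Ar L by (auto simp: dist_norm)
      finally show "?f x \<in> B" by (simp add: B_def dist_norm)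
    qed
    note lk = leb_kernel_frac_kernel[OF u, of "d + 2 * \<alpha>"]
    have lk': "leb_kernel (\<lambda>x y. frac_kernel (d + 2 * \<alpha>) u (?f x) (?f y))"
    proof -
      have "(\<lambda>z. (?f (fst z), ?f (snd z))) \<in> (lebesgue \<Otimes>\<^sub>M lebesgue) \<rightarrow>\<^sub>M (lebesgue \<Otimes>\<^sub>M lebesgue)"
        by (intro measurable_Pair measurable_compose[OF measurable_fst] measurable_compose[OF measurable_snd]
            radial_power_measurable[OF \<beta>])
      from measurable_compose[OF this lk[unfolded leb_kernel_def]] show ?thesis
        by (simp add: leb_kernel_def case_prod_beta)
    qed
    have "double_integral (frac_kernel (d + 2 * \<alpha>) (u \<circ> ?f)) A A
        \<le> double_integral (\<lambda>x y. ennreal (L powr (d + 2 * \<alpha>)) * frac_kernel (d + 2 * \<alpha>) u (?f x) (?f y)) A A"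
      by (intro double_integral_mono frac_kernel_comp_le) (use d \<alpha> L lip A in auto)
    also have "\<dots> = ennreal (L powr (d + 2 * \<alpha>)) * double_integral (\<lambda>x y. frac_kernel (d + 2 * \<alpha>) u (?f x) (?f y)) A A"
      by (rule double_integral_cmult[OF lk' A(1)])
    also have "\<dots> \<le> ennreal (L powr (d + 2 * \<alpha>)) *
        (ennreal ((2 * (radial_vol \<beta> q * \<sigma> powr (1 - \<beta>)) * DIM('a)) ^ (2 * DIM('a))) * double_integral (frac_kernel (d + 2 * \<alpha>) u) B B)"
      by (intro mult_left_mono double_integral_radial_power[OF \<beta> q s A lk _ fAB]) (auto simp: B_def)
    also have "\<dots> \<le> ennreal (L powr (d + 2 * \<alpha>)) *
        (ennreal ((2 * (radial_vol \<beta> q * \<sigma> powr (1 - \<beta>)) * DIM('a)) ^ (2 * DIM('a))) * ennreal (M * (L * r) powr (d - 2 * \<alpha>)))"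
      unfolding B_def d_def by (intro mult_left_mono energy_leD[OF bd]) (use L r in auto)
    also have "\<dots> = ennreal (L powr (d + 2 * \<alpha>) * ((v * \<sigma> powr (1 - \<beta>)) powr (2 * d) * (M * (L * r) powr (d - 2 * \<alpha>))))"
    proof -
      have "(2 * (radial_vol \<beta> q * \<sigma> powr (1 - \<beta>)) * DIM('a)) ^ (2 * DIM('a)) = (v * \<sigma> powr (1 - \<beta>)) ^ (2 * DIM('a))"
        by (simp add: v_def d_def mult_ac)
      also have "\<dots> = (v * \<sigma> powr (1 - \<beta>)) powr (2 * d)"
        using v s by (subst powr_realpow[symmetric]) (auto simp: d_def)
      finally show ?thesis using M by (simp flip: ennreal_mult)
    qed
    also have "L powr (d + 2 * \<alpha>) * ((v * \<sigma> powr (1 - \<beta>)) powr (2 * d) * (M * (L * r) powr (d - 2 * \<alpha>)))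
        = C * M * r powr (d - 2 * \<alpha>) *
          (\<sigma> powr ((\<beta> - 1) * (d + 2 * \<alpha>)) * \<sigma> powr ((1 - \<beta>) * (2 * d)) * \<sigma> powr ((\<beta> - 1) * (d - 2 * \<alpha>)))"
      using l v s r by (simp add: L_def C_def powr_mult powr_powr mult_ac)
    also have "\<sigma> powr ((\<beta> - 1) * (d + 2 * \<alpha>)) * \<sigma> powr ((1 - \<beta>) * (2 * d)) * \<sigma> powr ((\<beta> - 1) * (d - 2 * \<alpha>)) = 1"
    proof -
      have "(\<beta> - 1) * (d + 2 * \<alpha>) + (1 - \<beta>) * (2 * d) + (\<beta> - 1) * (d - 2 * \<alpha>) = 0"
        by (simp add: algebra_simps)
      then show ?thesis using s by (simp flip: powr_add)
    qed
    finally show "double_integral (frac_kernel (real DIM('a) + 2 * \<alpha>) (u \<circ> ?f)) A A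
          \<le> ennreal (C * M * r powr (real DIM('a) - 2 * \<alpha>))"
      by (simp only: d_def mult_1_right)
  qed
qed

section \<open>Dyadic annuli\<close>

lemma sq_kernel_triangle: "sq_kernel u x y \<le> 2 * sq_kernel u z y + 2 * sq_kernel u x z"
proof -
  have "\<bar>u x - u y\<bar>\<^sup>2 \<le> 2 * \<bar>u z - u y\<bar>\<^sup>2 + 2 * \<bar>u x - u z\<bar>\<^sup>2"
    using sum_squares_bound[of "u z - u y" "u x - u z"] by (simp add: power2_eq_square algebra_simps)
  then have "ennreal (\<bar>u x - u y\<bar>\<^sup>2) \<le> ennreal (2 * \<bar>u z - u y\<bar>\<^sup>2 + 2 * \<bar>u x - u z\<bar>\<^sup>2)"
    by (rule ennreal_leI)
  then show ?thesis by (simp add: sq_kernel_def ennreal_plus ennreal_mult)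
qed

text \<open>Integrate the pointwise inequality over \<open>x\<close> in \<open>B\<close>,
  \<open>y\<close> in \<open>A\<close> and an intermediate point \<open>z\<close> in
  \<open>D\<close>: the variable missing from each term contributes the measure of its set.\<close>

lemma double_integral_sq_kernel_triangle:
  assumes u: "u \<in> borel_measurable lebesgue"
    and A: "A \<in> sets lebesgue" and B: "B \<in> sets lebesgue" and D: "D \<in> sets lebesgue"
  shows "emeasure lebesgue D * double_integral (sq_kernel u) A B \<le>
    2 * (emeasure lebesgue B * double_integral (sq_kernel u) A D + emeasure lebesgue A * double_integral (sq_kernel u) D B)"
proof -
  let ?s = "sq_kernel u"
  note lk = leb_kernel_sq_kernel[OF u]
  define e where "e S = emeasure lebesgue S" for S :: "'a set"
  have em: "emeasure (lebesgue_on S) S = e S" if "S \<in> sets lebesgue" for S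
    using that by (simp add: e_def emeasure_restrict_space)
  have sec: "(\<lambda>x. ?s x y) \<in> borel_measurable (lebesgue_on S)" "(\<lambda>x. ?s y x) \<in> borel_measurable (lebesgue_on S)" for y S
    using leb_kernel_section[OF lk] leb_kernel_section[OF leb_kernel_swap[OF lk]] by auto
  have inner: "(\<lambda>y. \<integral>\<^sup>+x. ?s x y \<partial>lebesgue_on S) \<in> borel_measurable (lebesgue_on T)"
      "(\<lambda>y. \<integral>\<^sup>+x. ?s y x \<partial>lebesgue_on S) \<in> borel_measurable (lebesgue_on T)" if "S \<in> sets lebesgue" for S T
    using leb_kernel_inner[OF lk that] leb_kernel_inner[OF leb_kernel_swap[OF lk] that] by auto
  note [simp] = sec inner[OF A] inner[OF B] inner[OF D]
  note [measurable] = sec inner[OF A] inner[OF B] inner[OF D]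
  have "e D * double_integral ?s A B =
      (\<integral>\<^sup>+y. (\<integral>\<^sup>+x. (\<integral>\<^sup>+z. ?s x y \<partial>lebesgue_on D) \<partial>lebesgue_on B) \<partial>lebesgue_on A)"
    by (simp add: double_integral_def em D nn_integral_multc mult.commute[of "e D"])
  also have "\<dots> \<le> (\<integral>\<^sup>+y. (\<integral>\<^sup>+x. (\<integral>\<^sup>+z. 2 * ?s z y + 2 * ?s x z \<partial>lebesgue_on D) \<partial>lebesgue_on B) \<partial>lebesgue_on A)"
    by (intro nn_integral_mono sq_kernel_triangle)
  also have "\<dots> = (\<integral>\<^sup>+y. (\<integral>\<^sup>+x. 2 * (\<integral>\<^sup>+z. ?s z y \<partial>lebesgue_on D) + 2 * (\<integral>\<^sup>+z. ?s x z \<partial>lebesgue_on D) \<partial>lebesgue_on B) \<partial>lebesgue_on A)"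
    by (intro nn_integral_cong trans[OF nn_integral_add]) (auto simp: nn_integral_cmult)
  also have "\<dots> = (\<integral>\<^sup>+y. 2 * (\<integral>\<^sup>+z. ?s z y \<partial>lebesgue_on D) * e B + 2 * (\<integral>\<^sup>+x. (\<integral>\<^sup>+z. ?s x z \<partial>lebesgue_on D) \<partial>lebesgue_on B) \<partial>lebesgue_on A)"
    by (intro nn_integral_cong trans[OF nn_integral_add]) (auto simp: nn_integral_cmult em B)
  also have "\<dots> = 2 * double_integral ?s A D * e B + 2 * double_integral (\<lambda>x y. ?s y x) B D * e A"
    by (intro trans[OF nn_integral_add]) (auto simp: nn_integral_cmult nn_integral_multc em A double_integral_def)
  also have "double_integral (\<lambda>x y. ?s y x) B D = double_integral ?s D B"
    by (rule double_integral_swap[OF lk D B, symmetric])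
  finally show ?thesis unfolding e_def by (simp only: distrib_left mult_ac)
qed

text \<open>The half-open form makes it a difference of two open balls, and the dyadic annuli tile
  the punctured ball.\<close>

definition annulus :: "real \<Rightarrow> 'a::real_normed_vector set" where
  "annulus \<sigma> = {x. \<sigma> / 2 \<le> norm x \<and> norm x < \<sigma>}"

lemma annulus_eq: "annulus \<sigma> = ball 0 \<sigma> - ball 0 (\<sigma> / 2)"
  by (auto simp: annulus_def)

lemma annulus_lebesgue [simp]: "annulus \<sigma> \<in> sets (lebesgue :: 'a::euclidean_space measure)"
  unfolding annulus_eq by simp

lemma emeasure_annulus:
  obtains V where "0 < V"
    "\<And>\<sigma>. 0 < \<sigma> \<Longrightarrow> emeasure lebesgue (annulus \<sigma> :: 'a::euclidean_space set) = ennreal (V * \<sigma> powr DIM('a))"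
proof (rule that)
  let ?V = "measure lborel (ball (0::'a) 1) * (1 - (1/2) ^ DIM('a))"
  have "(1/2::real) ^ DIM('a) < 1" by (intro power_less_one_iff[THEN iffD2]) auto
  then show "0 < ?V" using content_ball_pos[of 1 "0::'a"] by simp
  fix \<sigma> :: real assume s: "0 < \<sigma>"
  have fin: "emeasure lebesgue (ball (0::'a) r) = ennreal (measure lebesgue (ball (0::'a) r))" for r
    by (rule emeasure_eq_measure2[OF lmeasurable_ball])
  have "emeasure lebesgue (annulus \<sigma> :: 'a set) = emeasure lebesgue (ball (0::'a) \<sigma>) - emeasure lebesgue (ball (0::'a) (\<sigma> / 2))"
    unfolding annulus_eq by (rule emeasure_Diff) (use s fin in \<open>auto intro!: subset_ball\<close>)
  also have "\<dots> = ennreal (measure lebesgue (ball (0::'a) \<sigma>) - measure lebesgue (ball (0::'a) (\<sigma> / 2)))"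
    unfolding fin by (rule ennreal_minus) simp
  also have "measure lebesgue (ball (0::'a) \<sigma>) - measure lebesgue (ball (0::'a) (\<sigma> / 2)) = ?V * \<sigma> ^ DIM('a)"
    using content_ball_conv_unit_ball[of \<sigma> "0::'a"] content_ball_conv_unit_ball[of "\<sigma>/2" "0::'a"] s
    by (simp add: power_divide algebra_simps)
  finally show "emeasure lebesgue (annulus \<sigma> :: 'a set) = ennreal (?V * \<sigma> powr DIM('a))"
    using s by (simp add: powr_realpow)
qed

text \<open>Telescoping over dyadic annuli: \<open>T m\<close> gains the factor \<open>2 * 2 powr -d \<le> 1 / 2\<close> in each step,
  which is where \<open>d \<ge> 2\<close> enters.\<close>
lemma sq_energy_annuli:
  fixes u :: "'a::euclidean_space \<Rightarrow> real"
  assumes u: "u \<in> borel_measurable lebesgue" and d: "2 \<le> DIM('a)" and K: "0 \<le> K" and \<sigma>: "0 < \<sigma>"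
    and base0: "double_integral (sq_kernel u) (annulus \<sigma>) (annulus \<sigma>) \<le> ennreal (K * \<sigma> powr (2 * real DIM('a)))"
    and base: "\<And>\<tau>. 0 < \<tau> \<Longrightarrow> double_integral (sq_kernel u) (annulus \<tau>) (annulus (\<tau> / 2)) \<le> ennreal (K * \<tau> powr (2 * real DIM('a)))"
  shows "double_integral (sq_kernel u) (annulus \<sigma>) (annulus (\<sigma> / 2 ^ m))
      \<le> ennreal (8 * K * \<sigma> powr (2 * real DIM('a)) * (3/4) ^ m)"
proof (induction m)
  case 0
  have "K * \<sigma> powr (2 * real DIM('a)) \<le> 8 * K * \<sigma> powr (2 * real DIM('a))" using K by simp
  then show ?case using base0 by (simp add: order_trans ennreal_leI)
next
  case (Suc m)
  define d where "d = real DIM('a)"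
  define T where "T m = double_integral (sq_kernel u) (annulus \<sigma>) (annulus (\<sigma> / 2 ^ m))" for m :: nat
  obtain V where V: "0 < V" and emV:
    "\<And>\<sigma>. 0 < \<sigma> \<Longrightarrow> emeasure lebesgue (annulus \<sigma> :: 'a set) = ennreal (V * \<sigma> powr DIM('a))"
    using emeasure_annulus by blast
  \<comment> \<open>The annulus at \<open>\<tau>\<close> is the intermediate set: the induction
    hypothesis leads from \<open>\<sigma>\<close> to \<open>\<tau>\<close>, and \<open>base\<close>
    leads from \<open>\<tau>\<close> to \<open>\<tau> / 2\<close>.\<close>
  define \<tau> where "\<tau> = \<sigma> / 2 ^ m"
  have \<tau>: "0 < \<tau>" and T1: "T (Suc m) = double_integral (sq_kernel u) (annulus \<sigma>) (annulus (\<tau> / 2))"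
    and T0: "T m = double_integral (sq_kernel u) (annulus \<sigma>) (annulus \<tau>)"
    using \<sigma> by (auto simp: \<tau>_def T_def mult.commute)
  define h where "h = (1/2) powr d"
  have h: "0 \<le> h" "h \<le> 1/4"
  proof -
    have "h \<le> (1/2) powr 2" unfolding h_def using d by (intro powr_mono') (auto simp: d_def)
    then show "h \<le> 1/4" by (simp add: power_divide)
  qed (simp add: h_def)
  have \<tau>h: "(\<tau> / 2) powr d = h * \<tau> powr d" using \<tau> by (simp add: h_def powr_divide)
  have \<tau>\<sigma>: "\<tau> powr d \<le> (1/4) ^ m * \<sigma> powr d"
  proof -
    have "\<tau> powr d = ((1/2) ^ m) powr d * \<sigma> powr d"
      using \<sigma> by (simp add: \<tau>_def powr_divide power_one_over field_simps)
    also have "((1/2::real) ^ m) powr d = h ^ m"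
      by (simp add: h_def powr_powr mult.commute flip: powr_realpow)
    also have "h ^ m \<le> (1/4) ^ m" using h by (intro power_mono)
    finally show ?thesis by (simp add: mult_right_mono)
  qed
  \<comment> \<open>After division by the measure of the intermediate annulus, the old term
    contributes at most \<open>W / 2\<close> because \<open>h \<le> 1/4\<close>. The new one is at
    most \<open>2 * K * \<sigma> powr (2 * d) * (3/4) ^ m\<close>; the constant 8 makes this
    \<open>W / 4\<close>. Together they give the ratio 3/4.\<close>
  define W where "W = 8 * K * \<sigma> powr (2 * d) * (3/4) ^ m"
  have W: "0 \<le> W" using K by (simp add: W_def)
  have "ennreal (V * \<tau> powr d) * T (Suc m) \<le> 2 * (ennreal (V * (h * \<tau> powr d)) * T m +
      ennreal (V * \<sigma> powr d) * double_integral (sq_kernel u) (annulus \<tau>) (annulus (\<tau> / 2)))"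
  proof -
    have "emeasure lebesgue (annulus (\<tau> / 2) :: 'a set) = ennreal (V * (h * \<tau> powr d))"
      using emV[of "\<tau> / 2"] \<tau> \<tau>h by (simp only: d_def)
    then show ?thesis
      using double_integral_sq_kernel_triangle[OF u, of "annulus \<sigma>" "annulus (\<tau> / 2)" "annulus \<tau>"]
      unfolding T1 T0 emV[OF \<tau>, folded d_def] emV[OF \<sigma>, folded d_def] by simp
  qed
  also have "\<dots> \<le> 2 * (ennreal (V * (h * \<tau> powr d)) * ennreal W + ennreal (V * \<sigma> powr d) * ennreal (K * \<tau> powr (2 * d)))"
    using Suc base[OF \<tau>] by (intro mult_left_mono add_mono) (auto simp: T_def W_def d_def)
  also have "\<dots> = ennreal (2 * (V * (h * \<tau> powr d) * W + V * \<sigma> powr d * (K * \<tau> powr (2 * d))))"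
    using V K W h by (simp add: ennreal_mult ennreal_plus)
  also have "\<dots> \<le> ennreal (V * \<tau> powr d * (3/4 * W))"
  proof (rule ennreal_leI)
    have "\<tau> powr (2 * d) = \<tau> powr d * \<tau> powr d" "\<sigma> powr (2 * d) = \<sigma> powr d * \<sigma> powr d"
      by (simp_all flip: powr_add)
    note sq = this
    have "2 * \<sigma> powr d * K * \<tau> powr d \<le> 2 * \<sigma> powr d * K * ((1/4) ^ m * \<sigma> powr d)"
      using K \<tau>\<sigma> by (intro mult_left_mono) auto
    also have "\<dots> = 2 * K * \<sigma> powr (2 * d) * (1/4) ^ m" by (simp add: sq)
    also have "\<dots> \<le> 2 * K * \<sigma> powr (2 * d) * (3/4) ^ m"
      using K by (intro mult_left_mono power_mono) auto
    also have "\<dots> = W / 4" by (simp add: W_def)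
    finally have 1: "2 * \<sigma> powr d * K * \<tau> powr d \<le> W / 4" .
    have 2: "2 * h * W \<le> W / 2" using mult_right_mono[OF h(2) W] by simp
    have "2 * (V * (h * \<tau> powr d) * W + V * \<sigma> powr d * (K * \<tau> powr (2 * d)))
        = V * \<tau> powr d * (2 * h * W + 2 * \<sigma> powr d * K * \<tau> powr d)"
      by (simp only: sq) (simp add: algebra_simps)
    also have "\<dots> \<le> V * \<tau> powr d * (3/4 * W)"
      using 1 2 V by (intro mult_left_mono) auto
    finally show "2 * (V * (h * \<tau> powr d) * W + V * \<sigma> powr d * (K * \<tau> powr (2 * d))) \<le> V * \<tau> powr d * (3/4 * W)" .
  qed
  also have "\<dots> = ennreal (V * \<tau> powr d) * ennreal (3/4 * W)"
    by (rule ennreal_mult) (use V W in auto)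
  finally have "T (Suc m) \<le> ennreal (3/4 * W)"
    using V \<tau> by (subst (asm) ennreal_mult_le_mult_iff) auto
  then show ?case by (simp add: T_def W_def d_def mult_ac)
qed

text \<open>Used for well separated annuli, where the singularity of the kernel is not seen; the
  converse comparison below needs only an upper bound on the distance and feeds the
  telescoping.\<close>

lemma frac_kernel_le_sq_kernel:
  assumes "0 < \<delta>" "\<delta> \<le> norm (x - y)" "0 \<le> p"
  shows "frac_kernel p u x y \<le> ennreal (\<delta> powr - p) * sq_kernel u x y"
proof -
  have "0 < norm (x - y)" using assms by linarith
  have "\<delta> powr p \<le> norm (x - y) powr p" using assms by (intro powr_mono2) auto
  then have "\<bar>u x - u y\<bar>\<^sup>2 / norm (x - y) powr p \<le> \<bar>u x - u y\<bar>\<^sup>2 / \<delta> powr p"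
    using assms \<open>0 < norm (x - y)\<close> by (intro divide_left_mono mult_pos_pos) auto
  also have "\<dots> = \<delta> powr - p * \<bar>u x - u y\<bar>\<^sup>2" by (simp add: powr_minus divide_inverse mult.commute)
  finally show ?thesis
    by (simp add: frac_kernel_def sq_kernel_def ennreal_leI flip: ennreal_mult)
qed

lemma sq_kernel_le_frac_kernel:
  assumes "norm (x - y) \<le> \<delta>" "0 \<le> p"
  shows "sq_kernel u x y \<le> ennreal (\<delta> powr p) * frac_kernel p u x y"
proof (cases "x = y")
  case False
  then have "norm (x - y) powr p \<le> \<delta> powr p" using assms by (intro powr_mono2) auto
  then have "\<bar>u x - u y\<bar>\<^sup>2 * norm (x - y) powr p \<le> \<bar>u x - u y\<bar>\<^sup>2 * \<delta> powr p"
    by (intro mult_left_mono) auto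
  then have "\<bar>u x - u y\<bar>\<^sup>2 \<le> \<delta> powr p * (\<bar>u x - u y\<bar>\<^sup>2 / norm (x - y) powr p)"
    using False by (simp add: field_simps)
  then show ?thesis
    by (simp add: frac_kernel_def sq_kernel_def ennreal_leI flip: ennreal_mult)
qed (simp add: sq_kernel_def)

section \<open>Countable decompositions and summation over pairs of annuli\<close>

lemma nn_integral_lebesgue_on_UN_le:
  fixes \<phi> :: "'a::euclidean_space \<Rightarrow> ennreal" and F :: "nat \<Rightarrow> 'a set"
  assumes \<phi>[measurable]: "\<phi> \<in> borel_measurable lebesgue" and F[measurable]: "\<And>i. F i \<in> sets lebesgue"
  shows "nn_integral (lebesgue_on (\<Union>i. F i)) \<phi> \<le> (\<Sum>i. nn_integral (lebesgue_on (F i)) \<phi>)"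
proof -
  have "nn_integral (lebesgue_on (\<Union>i. F i)) \<phi> = (\<integral>\<^sup>+x. \<phi> x * indicator (\<Union>i. F i) x \<partial>lebesgue)"
    by (rule nn_integral_restrict_space) auto
  also have "\<dots> \<le> (\<integral>\<^sup>+x. (\<Sum>i. \<phi> x * indicator (F i) x) \<partial>lebesgue)"
  proof (rule nn_integral_mono)
    fix x
    show "\<phi> x * indicator (\<Union>i. F i) x \<le> (\<Sum>i. \<phi> x * indicator (F i) x)"
    proof (cases "x \<in> (\<Union>i. F i)")
      case True
      then obtain i where i: "x \<in> F i" by blast
      then have "\<phi> x * indicator (\<Union>i. F i) x = (\<Sum>i\<in>{i}. \<phi> x * indicator (F i) x)" using True by simp
      also have "\<dots> \<le> (\<Sum>i. \<phi> x * indicator (F i) x)" by (rule sum_le_suminf) auto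
      finally show ?thesis .
    qed simp
  qed
  also have "\<dots> = (\<Sum>i. \<integral>\<^sup>+x. \<phi> x * indicator (F i) x \<partial>lebesgue)"
    by (rule nn_integral_suminf) simp
  also have "\<dots> = (\<Sum>i. nn_integral (lebesgue_on (F i)) \<phi>)"
    by (simp add: nn_integral_restrict_space)
  finally show ?thesis .
qed

lemma double_integral_UN_le:
  fixes F :: "nat \<Rightarrow> 'a::euclidean_space set"
  assumes K: "leb_kernel K" and F: "\<And>i. F i \<in> sets lebesgue"
  shows "double_integral K (\<Union>i. F i) (\<Union>i. F i) \<le> (\<Sum>j. \<Sum>i. double_integral K (F i) (F j))"
proof -
  let ?U = "\<Union>i. F i"
  have sec: "(\<lambda>x. K x y) \<in> borel_measurable lebesgue" for y
    using leb_kernel_section[OF K, of y UNIV] by (simp add: lebesgue_on_UNIV_eq)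
  have "double_integral K ?U ?U \<le> (\<integral>\<^sup>+y. (\<Sum>j. \<integral>\<^sup>+x. K x y \<partial>lebesgue_on (F j)) \<partial>lebesgue_on ?U)"
    unfolding double_integral_def by (intro nn_integral_mono nn_integral_lebesgue_on_UN_le sec F)
  also have "\<dots> = (\<Sum>j. \<integral>\<^sup>+y. (\<integral>\<^sup>+x. K x y \<partial>lebesgue_on (F j)) \<partial>lebesgue_on ?U)"
    by (intro nn_integral_suminf leb_kernel_inner K F)
  also have "\<dots> \<le> (\<Sum>j. \<Sum>i. double_integral K (F i) (F j))"
    unfolding double_integral_def
    by (intro suminf_le nn_integral_lebesgue_on_UN_le leb_kernel_inner_lebesgue K F summableI)
  finally show ?thesis .
qed

lemma nn_integral_lebesgue_on_Diff_singleton: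
  fixes \<phi> :: "'a::euclidean_space \<Rightarrow> ennreal"
  assumes "A \<in> sets lebesgue"
  shows "nn_integral (lebesgue_on A) \<phi> = nn_integral (lebesgue_on (A - {a})) \<phi>"
proof -
  have "AE x in lebesgue. x \<noteq> a"
    by (rule AE_I'[of "{a}"]) auto
  then have "(\<integral>\<^sup>+x. \<phi> x * indicator A x \<partial>lebesgue) = (\<integral>\<^sup>+x. \<phi> x * indicator (A - {a}) x \<partial>lebesgue)"
    by (intro nn_integral_cong_AE) (auto split: split_indicator)
  then show ?thesis using assms by (subst (1 2) nn_integral_restrict_space) auto
qed

text \<open>A point is a null set. This is what removes the origin, both when a ball is cut into
  annuli and when a map is prescribed only off the origin.\<close>

lemma double_integral_Diff_singleton:
  assumes "A \<in> sets lebesgue" "B \<in> sets lebesgue"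
  shows "double_integral K A B = double_integral K (A - {a}) (B - {a})"
  unfolding double_integral_def
  by (subst nn_integral_lebesgue_on_Diff_singleton[OF assms(1), of _ a],
      subst nn_integral_lebesgue_on_Diff_singleton[OF assms(2), of _ a]) (rule refl)

lemma ball_minus_origin_eq_annuli:
  assumes "0 < R"
  shows "ball 0 R - {0 :: 'a::real_normed_vector} = (\<Union>j. annulus (R / 2 ^ j))"
proof
  show "(\<Union>j. annulus (R / 2 ^ j)) \<subseteq> ball 0 R - {0 :: 'a}"
  proof clarify
    fix x :: 'a and j assume x: "x \<in> annulus (R / 2 ^ j)"
    have "R / 2 ^ j \<le> R" using assms by (simp add: divide_le_eq)
    moreover have "0 < R / 2 ^ j / 2" using assms by simp
    ultimately show "x \<in> ball 0 R - {0}" using x unfolding annulus_def by auto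
  qed
  show "ball 0 R - {0 :: 'a} \<subseteq> (\<Union>j. annulus (R / 2 ^ j))"
  proof
    fix x :: 'a assume x: "x \<in> ball 0 R - {0}"
    define P where "P j \<longleftrightarrow> R / 2 ^ j \<le> norm x" for j :: nat
    have "\<exists>j. P j"
    proof -
      obtain j where "R / norm x < 2 ^ j" using real_arch_pow[of 2 "R / norm x"] by auto
      then have "P j" using x by (simp add: P_def field_simps)
      then show ?thesis ..
    qed
    \<comment> \<open>The least such index is positive because \<open>norm x < R\<close>; its
      predecessor is the index of the annulus containing \<open>x\<close>.\<close>
    then have LP: "P (LEAST j. P j)" by (rule LeastI_ex)
    have "\<not> P 0" using x by (simp add: P_def)
    then obtain k where k: "(LEAST j. P j) = Suc k" using LP by (metis not0_implies_Suc)
    then have "\<not> P k" using not_less_Least[of k P] by simp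
    then have "x \<in> annulus (R / 2 ^ k)" using LP k by (simp add: P_def annulus_def field_simps)
    then show "x \<in> (\<Union>j. annulus (R / 2 ^ j))" by blast
  qed
qed

text \<open>This is the part of the energy bound that a single shell can supply; joining two
  consecutive annuli includes the interaction of neighbours, where the kernel is singular at the
  common sphere.\<close>

definition annular_energy_le :: "real \<Rightarrow> real \<Rightarrow> ('a::euclidean_space \<Rightarrow> real) \<Rightarrow> bool" where
  "annular_energy_le \<alpha> M u \<longleftrightarrow> (\<forall>\<sigma>. 0 < \<sigma> \<longrightarrow>
    double_integral (frac_kernel (real DIM('a) + 2 * \<alpha>) u)
        (annulus \<sigma> \<union> annulus (\<sigma> / 2)) (annulus \<sigma> \<union> annulus (\<sigma> / 2)) \<le> ennreal (M * \<sigma> powr (real DIM('a) - 2 * \<alpha>)))"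

lemma frac_energy_annuli:
  fixes u :: "'a::euclidean_space \<Rightarrow> real" and \<alpha> M :: real
  assumes u: "u \<in> borel_measurable lebesgue" and d: "2 \<le> DIM('a)" and \<alpha>: "0 \<le> \<alpha>" and M: "0 \<le> M"
    and bd: "annular_energy_le \<alpha> M u"
    and \<sigma>: "0 < \<sigma>"
  shows "double_integral (frac_kernel (real DIM('a) + 2 * \<alpha>) u) (annulus \<sigma>) (annulus (\<sigma> / 2 ^ m))
      \<le> ennreal (8 powr (DIM('a) + 2 * \<alpha> + 1) * M * \<sigma> powr (real DIM('a) - 2 * \<alpha>) * (3/4) ^ m)"
proof -
  define d where "d = real DIM('a)"
  define p where "p = d + 2 * \<alpha>"
  have d2: "2 \<le> d" using d by (simp add: d_def)
  have p: "0 \<le> p" "2 \<le> p" using d2 \<alpha> by (auto simp: p_def)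
  let ?S = "\<lambda>\<tau>. annulus \<tau> \<union> annulus (\<tau> / 2) :: 'a set"
  have bd': "double_integral (frac_kernel p u) (?S \<tau>) (?S \<tau>) \<le> ennreal (M * \<tau> powr (d - 2 * \<alpha>))" if "0 < \<tau>" for \<tau>
    using bd that by (simp add: annular_energy_le_def p_def d_def)
  have near: "double_integral (frac_kernel p u) A B \<le> ennreal (M * \<tau> powr (d - 2 * \<alpha>))"
    if "0 < \<tau>" "A = annulus \<tau> \<or> A = annulus (\<tau> / 2)" "B = annulus \<tau> \<or> B = annulus (\<tau> / 2)" for \<tau> A B
    using that by (intro order_trans[OF double_integral_subset bd']) auto
  have sq_near: "double_integral (sq_kernel u) A B \<le> ennreal (2 powr p * M * \<tau> powr (2 * d))"
    if "0 < \<tau>" "A = annulus \<tau> \<or> A = annulus (\<tau> / 2)" "B = annulus \<tau> \<or> B = annulus (\<tau> / 2)" for \<tau> A B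
  proof -
    have "double_integral (sq_kernel u) A B \<le> double_integral (\<lambda>x y. ennreal ((2 * \<tau>) powr p) * frac_kernel p u x y) A B"
    proof (intro double_integral_mono sq_kernel_le_frac_kernel p)
      fix x y assume "y \<in> A" "x \<in> B"
      then have "norm x < \<tau>" "norm y < \<tau>" using that by (auto simp: annulus_def)
      then show "norm (x - y) \<le> 2 * \<tau>" using norm_triangle_ineq4[of x y] by simp
    qed
    also have "\<dots> = ennreal ((2 * \<tau>) powr p) * double_integral (frac_kernel p u) A B"
      by (rule double_integral_cmult[OF leb_kernel_frac_kernel[OF u]]) (use that in auto)
    also have "\<dots> \<le> ennreal ((2 * \<tau>) powr p) * ennreal (M * \<tau> powr (d - 2 * \<alpha>))"
      by (intro mult_left_mono near[OF that]) auto
    also have "\<dots> = ennreal ((2 * \<tau>) powr p * (M * \<tau> powr (d - 2 * \<alpha>)))"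
      using M by (simp add: ennreal_mult)
    also have "(2 * \<tau>) powr p * (M * \<tau> powr (d - 2 * \<alpha>)) = 2 powr p * M * (\<tau> powr p * \<tau> powr (d - 2 * \<alpha>))"
      using that by (simp add: powr_mult)
    also have "\<tau> powr p * \<tau> powr (d - 2 * \<alpha>) = \<tau> powr (2 * d)"
      by (simp add: p_def flip: powr_add)
    finally show ?thesis .
  qed
  define E where "E = \<sigma> powr (d - 2 * \<alpha>)"
  have "double_integral (frac_kernel p u) (annulus \<sigma>) (annulus (\<sigma> / 2 ^ m))
      \<le> ennreal (8 powr (p + 1) * M * E * (3/4) ^ m)"
  proof (cases "m < 2")
    case True
    then have m: "m = 0 \<or> m = 1" by auto
    \<comment> \<open>For an annulus with itself or its neighbour the bound is immediate; the
      constant only has to outweigh the factor \<open>(3/4) ^ m\<close>, which is at least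
      3/4.\<close>
    have "(8::real) powr (p + 1) \<ge> 8 powr 1" using p by (intro powr_mono) auto
    then have "2 * (M * E) \<le> 8 powr (p + 1) * (M * E)"
      using M by (intro mult_right_mono) (auto simp: E_def)
    moreover have "0 \<le> M * E" using M by (simp add: E_def)
    ultimately have "M * E \<le> 8 powr (p + 1) * (M * E) * (3/4) ^ m"
      using m by auto
    then have "M * E \<le> 8 powr (p + 1) * M * E * (3/4) ^ m"
      by (simp only: mult.assoc)
    then show ?thesis
      using near[OF \<sigma>, of "annulus \<sigma>" "annulus (\<sigma> / 2 ^ m)"] m by (auto simp: E_def intro: order_trans ennreal_leI)
  next
    case False
    have "double_integral (frac_kernel p u) (annulus \<sigma>) (annulus (\<sigma> / 2 ^ m))
      \<le> double_integral (\<lambda>x y. ennreal ((\<sigma> / 4) powr - p) * sq_kernel u x y) (annulus \<sigma>) (annulus (\<sigma> / 2 ^ m))"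
    proof (intro double_integral_mono frac_kernel_le_sq_kernel p)
      fix x y :: 'a assume y: "y \<in> annulus \<sigma>" and x: "x \<in> annulus (\<sigma> / 2 ^ m)"
      have "(2::real) ^ 2 \<le> 2 ^ m" using False by (intro power_increasing) auto
      then have "\<sigma> / 2 ^ m \<le> \<sigma> / 4" using \<sigma> by (intro divide_left_mono) auto
      moreover have "norm x < \<sigma> / 2 ^ m" "\<sigma> / 2 \<le> norm y" using x y by (simp_all add: annulus_def)
      ultimately have "norm x \<le> \<sigma> / 4" "\<sigma> / 2 \<le> norm y" by linarith+
      then show "\<sigma> / 4 \<le> norm (x - y)" using norm_triangle_ineq2[of y x] by (simp add: norm_minus_commute)
    qed (use \<sigma> in auto)
    also have "\<dots> = ennreal ((\<sigma> / 4) powr - p) * double_integral (sq_kernel u) (annulus \<sigma>) (annulus (\<sigma> / 2 ^ m))"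
      by (rule double_integral_cmult[OF leb_kernel_sq_kernel[OF u]]) auto
    also have "\<dots> \<le> ennreal ((\<sigma> / 4) powr - p) * ennreal (8 * (2 powr p * M) * \<sigma> powr (2 * d) * (3/4) ^ m)"
    proof (rule mult_left_mono)
      show "double_integral (sq_kernel u) (annulus \<sigma>) (annulus (\<sigma> / 2 ^ m))
          \<le> ennreal (8 * (2 powr p * M) * \<sigma> powr (2 * d) * (3/4) ^ m)"
        unfolding d_def
      proof (rule sq_energy_annuli[OF u d _ \<sigma>])
        show "0 \<le> 2 powr p * M" using M by simp
      qed (use sq_near[unfolded d_def] \<sigma> in auto)
    qed simp
    also have "\<dots> = ennreal ((\<sigma> / 4) powr - p * (8 * (2 powr p * M) * \<sigma> powr (2 * d) * (3/4) ^ m))"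
      using M by (simp add: ennreal_mult)
    \<comment> \<open>The constant combines \<open>4 powr p\<close> from the separation
      \<open>\<sigma> / 4\<close>, \<open>2 powr p\<close> from the diameter bound in
      \<open>sq_near\<close>, and 8 from the telescoping.\<close>
    also have "(\<sigma> / 4) powr - p * (8 * (2 powr p * M) * \<sigma> powr (2 * d) * (3/4) ^ m) = 8 powr (p + 1) * M * E * (3/4) ^ m"
    proof -
      have "(\<sigma> / 4) powr - p = 4 powr p * \<sigma> powr - p"
        using \<sigma> by (simp add: powr_divide powr_minus_divide)
      moreover have "\<sigma> powr - p * \<sigma> powr (2 * d) = E"
        by (simp add: E_def p_def flip: powr_add)
      moreover have "8 powr (p + 1) = 8 * (4 powr p * 2 powr p)"
        by (simp add: powr_add flip: powr_mult)
      ultimately show ?thesis by (simp add: mult_ac)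
    qed
    finally show ?thesis .
  qed
  then show ?thesis by (simp add: p_def d_def E_def)
qed

lemma suminf_ennreal_double_geometric:
  fixes b c :: real
  assumes b: "0 \<le> b" "b < 1" and c: "0 \<le> c"
  shows "(\<Sum>j. \<Sum>i. ennreal (c * b ^ i * b ^ j)) = ennreal (c / (1 - b)\<^sup>2)"
proof -
  have geo: "(\<lambda>i. b ^ i) sums (1 / (1 - b))" using b by (intro geometric_sums) auto
  have "(\<Sum>i. ennreal (c * b ^ i * b ^ j)) = ennreal (c * b ^ j / (1 - b))" for j
  proof (rule suminf_ennreal_eq)
    show "(\<lambda>i. c * b ^ i * b ^ j) sums (c * b ^ j / (1 - b))"
      using sums_mult[OF geo, of "c * b ^ j"] by (simp add: mult_ac)
  qed (use b c in auto)
  moreover have "(\<Sum>j. ennreal (c * b ^ j / (1 - b))) = ennreal (c / (1 - b)\<^sup>2)"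
  proof (rule suminf_ennreal_eq)
    show "(\<lambda>j. c * b ^ j / (1 - b)) sums (c / (1 - b)\<^sup>2)"
      using sums_mult[OF geo, of "c / (1 - b)"] by (simp add: mult_ac power2_eq_square)
  qed (use b c in auto)
  ultimately show ?thesis by simp
qed

lemma frac_energy_centred_ball:
  fixes \<alpha> :: real
  assumes d: "2 \<le> DIM('a::euclidean_space)" and \<alpha>: "0 \<le> \<alpha>" "\<alpha> < 1"
  obtains C where "0 < C"
    "\<And>(u :: 'a \<Rightarrow> real) M R. u \<in> borel_measurable lebesgue \<Longrightarrow> 0 \<le> M \<Longrightarrow>
      annular_energy_le \<alpha> M u \<Longrightarrow>
      0 < R \<Longrightarrow>
      double_integral (frac_kernel (real DIM('a) + 2 * \<alpha>) u) (ball 0 R) (ball 0 R) \<le> ennreal (C * M * R powr (real DIM('a) - 2 * \<alpha>))"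
proof -
  define d where "d = real DIM('a)"
  define p where "p = d + 2 * \<alpha>"
  define s where "s = d - 2 * \<alpha>"
  have s: "0 < s" using assms by (simp add: s_def d_def)
  define a where "a = (1/2) powr s"
  have a: "0 \<le> a" "a < 1"
    using gr_one_powr[of 2 s] s by (auto simp: a_def powr_divide)
  \<comment> \<open>The bound for the pair \<open>j\<close>, \<open>j + m\<close> decays like
    \<open>a ^ j * (3/4) ^ m\<close>. The square root turns this into the symmetric product
    \<open>b ^ j * b ^ (j + m)\<close>, which sums as two independent geometric series.\<close>
  define b where "b = max (sqrt a) (3/4)"
  have b: "0 \<le> b" "b < 1" "3/4 \<le> b" "sqrt a \<le> b" using a by (auto simp: b_def)
  have ab: "a \<le> b\<^sup>2" using b a by (metis real_sqrt_le_iff real_sqrt_abs abs_of_nonneg)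
  define C1 where "C1 = 8 powr (p + 1)"
  show thesis
  proof (rule that)
    show "0 < C1 / (1 - b)\<^sup>2" using b by (simp add: C1_def)
    fix u :: "'a \<Rightarrow> real" and M R :: real
    assume u: "u \<in> borel_measurable lebesgue" and M: "0 \<le> M" and R: "0 < R"
      and bd: "annular_energy_le \<alpha> M u"
    define c where "c = C1 * M * R powr s"
    have c: "0 \<le> c" using M by (simp add: c_def C1_def)
    define A where "A j = (annulus (R / 2 ^ j) :: 'a set)" for j :: nat
    have Aleb: "A j \<in> sets lebesgue" for j by (simp add: A_def)
    let ?D = "double_integral (frac_kernel p u)"
    have 1: "?D (A j) (A (j + m)) \<le> ennreal (c * b ^ j * b ^ (j + m))" for j m
    proof -
      have "?D (A j) (A (j + m)) \<le> ennreal (C1 * M * (R / 2 ^ j) powr s * (3/4) ^ m)"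
        using frac_energy_annuli[OF u d \<alpha>(1) M bd, of "R / 2 ^ j" m] R
        by (simp add: A_def C1_def p_def s_def d_def power_add)
      also have "\<dots> \<le> ennreal (c * b ^ j * b ^ (j + m))"
      proof (rule ennreal_leI)
        have "(R / 2 ^ j) powr s = R powr s * ((1/2) ^ j) powr s"
          using R by (simp add: powr_divide power_one_over field_simps)
        also have "((1/2::real) ^ j) powr s = a ^ j"
          by (simp add: a_def powr_powr mult.commute flip: powr_realpow)
        finally have "C1 * M * (R / 2 ^ j) powr s * (3/4) ^ m = c * (a ^ j * (3/4) ^ m)"
          by (simp add: c_def)
        also have "\<dots> \<le> c * ((b\<^sup>2) ^ j * b ^ m)"
          using c a ab b by (intro mult_left_mono mult_mono power_mono) auto
        also have "\<dots> = c * b ^ j * b ^ (j + m)"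
          by (simp add: power_add power2_eq_square power_mult_distrib mult_ac)
        finally show "C1 * M * (R / 2 ^ j) powr s * (3/4) ^ m \<le> c * b ^ j * b ^ (j + m)" .
      qed
      finally show ?thesis .
    qed
    have 2: "?D (A i) (A j) \<le> ennreal (c * b ^ i * b ^ j)" for i j
    proof (cases "i \<le> j")
      case True
      then show ?thesis using 1[of i "j - i"] by simp
    next
      case False
      then have "?D (A j) (A i) \<le> ennreal (c * b ^ i * b ^ j)"
        using 1[of j "i - j"] by (simp add: mult_ac)
      then show ?thesis
        using double_integral_frac_kernel_commute[OF u Aleb Aleb] by metis
    qed
    have "?D (ball 0 R) (ball 0 R) = ?D (\<Union>j. A j) (\<Union>j. A j)"
      unfolding A_def ball_minus_origin_eq_annuli[OF R, symmetric]
      by (rule double_integral_Diff_singleton) auto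
    also have "\<dots> \<le> (\<Sum>j. \<Sum>i. ?D (A i) (A j))"
      by (rule double_integral_UN_le[OF leb_kernel_frac_kernel[OF u] Aleb])
    also have "\<dots> \<le> (\<Sum>j. \<Sum>i. ennreal (c * b ^ i * b ^ j))"
      by (intro suminf_le 2 summableI)
    also have "\<dots> = ennreal (c / (1 - b)\<^sup>2)"
      by (rule suminf_ennreal_double_geometric[OF b(1,2) c])
    finally show "double_integral (frac_kernel (real DIM('a) + 2 * \<alpha>) u) (ball 0 R) (ball 0 R)
        \<le> ennreal (C1 / (1 - b)\<^sup>2 * M * R powr (real DIM('a) - 2 * \<alpha>))"
      by (simp add: c_def p_def s_def d_def)
  qed
qed

section \<open>Balls and the Q norm\<close>

lemma frac_energy_radial_power:
  fixes \<alpha> \<beta> :: real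
  assumes d: "2 \<le> DIM('a::euclidean_space)" and \<alpha>: "0 \<le> \<alpha>" "\<alpha> < 1" and \<beta>: "\<beta> \<noteq> 0"
  obtains C where "0 < C"
    "\<And>(u :: 'a \<Rightarrow> real) M. u \<in> borel_measurable lebesgue \<Longrightarrow> 0 \<le> M \<Longrightarrow>
      energy_le \<alpha> M u \<Longrightarrow> energy_le \<alpha> (C * M) (u \<circ> radial_power \<beta>)"
proof -
  define p where "p = DIM('a) + 2 * \<alpha>"
  define s where "s = DIM('a) - 2 * \<alpha>"
  \<comment> \<open>Two consecutive annuli have norms from \<open>\<sigma> / 4\<close> up to
    \<open>\<sigma>\<close>, which fixes the shell parameter 4; balls with
    \<open>2 * r \<le> norm x0\<close> fit into such a shell too.\<close>
  have q4: "1 \<le> (4::real)" by simp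
  obtain C1 where C1: "0 < C1"
    "\<And>(u :: 'a \<Rightarrow> real) M \<sigma> A x0 r.
      u \<in> borel_measurable lebesgue \<Longrightarrow> 0 \<le> M \<Longrightarrow>
      energy_le \<alpha> M u \<Longrightarrow> 0 < \<sigma> \<Longrightarrow> A \<in> sets lebesgue \<Longrightarrow> A \<subseteq> shell 4 \<sigma> \<Longrightarrow> x0 \<in> shell 4 \<sigma> \<Longrightarrow> 0 < r \<Longrightarrow> A \<subseteq> ball x0 r \<Longrightarrow>
      double_integral (frac_kernel p (u \<circ> radial_power \<beta>)) A A \<le> ennreal (C1 * M * r powr s)"
    by (rule frac_energy_radial_power_shell[where 'a='a, OF \<beta> q4 \<alpha>(1), folded p_def s_def]) (rule that)
  obtain C2 where C2: "0 < C2"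
    "\<And>(u :: 'a \<Rightarrow> real) M R. u \<in> borel_measurable lebesgue \<Longrightarrow> 0 \<le> M \<Longrightarrow>
      annular_energy_le \<alpha> M u \<Longrightarrow> 0 < R \<Longrightarrow> double_integral (frac_kernel p u) (ball 0 R) (ball 0 R) \<le> ennreal (C2 * M * R powr s)"
    by (rule frac_energy_centred_ball[OF d \<alpha>, folded p_def s_def]) (rule that)
  \<comment> \<open>Far balls cost \<open>C1\<close>. Near ones lie in the centred ball of radius
    \<open>3 * r\<close>, and each pair of annuli lies in a ball of radius
    \<open>2 * \<sigma>\<close> centred at a point of norm \<open>\<sigma>\<close>.\<close>
  define C where "C = max C1 (C2 * C1 * 2 powr s * 3 powr s)"
  show thesis
  proof (rule that[folded p_def s_def])
    show "0 < C" using C1(1) by (simp add: C_def)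
    fix u :: "'a \<Rightarrow> real" and M :: real
    assume u: "u \<in> borel_measurable lebesgue" and M: "0 \<le> M" and bd: "energy_le \<alpha> M u"
    let ?v = "u \<circ> radial_power \<beta>"
    let ?D = "double_integral (frac_kernel p ?v)"
    have v: "?v \<in> borel_measurable lebesgue"
      using radial_power_measurable[OF \<beta>] u by (rule measurable_comp)
    have "?D (ball x0 r) (ball x0 r) \<le> ennreal (C * M * r powr s)" if r: "0 < r" for x0 r
    proof (cases "2 * r \<le> norm x0")
      case True
      have pos: "0 < norm x0" using True r by linarith
      have sub: "ball x0 r \<subseteq> shell 4 (norm x0)"
      proof
        fix x assume "x \<in> ball x0 r"
        then have "norm (x0 - x) < r" by (simp add: dist_norm)
        then show "x \<in> shell 4 (norm x0)"
          using True r norm_triangle_ineq2[of x0 x] norm_triangle_ineq2[of x x0]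
          by (simp add: shell_def norm_minus_commute)
      qed
      have "?D (ball x0 r) (ball x0 r) \<le> ennreal (C1 * M * r powr s)"
        by (rule C1(2)[OF u M bd pos _ sub _ r]) (auto simp: shell_def)
      also have "\<dots> \<le> ennreal (C * M * r powr s)"
        using M by (intro ennreal_leI mult_right_mono) (auto simp: C_def)
      finally show ?thesis .
    next
      case False
      have ann: "annular_energy_le \<alpha> (C1 * M * 2 powr s) ?v"
        unfolding annular_energy_le_def p_def[symmetric] s_def[symmetric]
      proof (intro allI impI)
        fix \<sigma> :: real assume \<sigma>: "0 < \<sigma>"
        obtain z :: 'a where z: "norm z = \<sigma>" using vector_choose_size[of \<sigma>] \<sigma> by auto
        have "?D (annulus \<sigma> \<union> annulus (\<sigma> / 2)) (annulus \<sigma> \<union> annulus (\<sigma> / 2)) \<le> ennreal (C1 * M * (2 * \<sigma>) powr s)"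
        proof (rule C1(2)[OF u M bd \<sigma>, of _ z])
          show "annulus \<sigma> \<union> annulus (\<sigma> / 2) \<subseteq> shell 4 \<sigma>"
            using \<sigma> by (auto simp: annulus_def shell_def)
          show "annulus \<sigma> \<union> annulus (\<sigma> / 2) \<subseteq> ball z (2 * \<sigma>)"
          proof
            fix x :: 'a assume "x \<in> annulus \<sigma> \<union> annulus (\<sigma> / 2)"
            then have "norm x < \<sigma>" using \<sigma> by (auto simp: annulus_def)
            then show "x \<in> ball z (2 * \<sigma>)" using norm_triangle_ineq4[of z x] z by (simp add: dist_norm)
          qed
        qed (use z \<sigma> in \<open>auto simp: shell_def\<close>)
        also have "C1 * M * (2 * \<sigma>) powr s = C1 * M * 2 powr s * \<sigma> powr s"
          using \<sigma> by (simp add: powr_mult)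
        finally show "?D (annulus \<sigma> \<union> annulus (\<sigma> / 2)) (annulus \<sigma> \<union> annulus (\<sigma> / 2)) \<le> ennreal (C1 * M * 2 powr s * \<sigma> powr s)" .
      qed
      have "ball x0 r \<subseteq> ball 0 (3 * r)"
      proof
        fix x assume "x \<in> ball x0 r"
        then have "norm (x0 - x) < r" by (simp add: dist_norm)
        then show "x \<in> ball 0 (3 * r)"
          using False norm_triangle_ineq2[of x x0] by (simp add: norm_minus_commute)
      qed
      then have "?D (ball x0 r) (ball x0 r) \<le> ?D (ball 0 (3 * r)) (ball 0 (3 * r))"
        by (intro double_integral_subset) auto
      also have "\<dots> \<le> ennreal (C2 * (C1 * M * 2 powr s) * (3 * r) powr s)"
        by (rule C2(2)[OF v _ ann]) (use C1 M r in auto)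
      also have "C2 * (C1 * M * 2 powr s) * (3 * r) powr s = (C2 * C1 * 2 powr s * 3 powr s) * M * r powr s"
        using r by (simp add: powr_mult mult_ac)
      also have "ennreal \<dots> \<le> ennreal (C * M * r powr s)"
        using M by (intro ennreal_leI mult_right_mono) (auto simp: C_def)
      finally show ?thesis .
    qed
    then show "energy_le \<alpha> (C * M) ?v" by (simp add: energy_le_def p_def s_def)
  qed
qed

section \<open>From energies back to the function space\<close>

lemma L2_loc_if_frac_energy_finite:
  fixes u :: "real ^ 'n \<Rightarrow> real"
  assumes u: "u \<in> borel_measurable lebesgue" and p: "0 \<le> p"
    and fin: "\<And>R. 0 < R \<Longrightarrow> double_integral (frac_kernel p u) (ball 0 R) (ball 0 R) < \<infinity>"
  shows "u \<in> L2_loc"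
proof -
  have "set_integrable lebesgue K (\<lambda>x. (u x)\<^sup>2)" if K: "compact K" for K
  proof -
    obtain R where R: "0 < R" "K \<subseteq> ball 0 R"
      using bounded_subset_ballD[OF compact_imp_bounded[OF K], of 0] by blast
    let ?B = "ball (0 :: real ^ 'n) R"
    have "double_integral (sq_kernel u) ?B ?B \<le> double_integral (\<lambda>x y. ennreal ((2 * R) powr p) * frac_kernel p u x y) ?B ?B"
    proof (intro double_integral_mono sq_kernel_le_frac_kernel p)
      fix x y assume "y \<in> ?B" "x \<in> ?B"
      then show "norm (x - y) \<le> 2 * R" using norm_triangle_ineq4[of x y] by simp
    qed
    also have "\<dots> = ennreal ((2 * R) powr p) * double_integral (frac_kernel p u) ?B ?B"
      by (rule double_integral_cmult[OF leb_kernel_frac_kernel[OF u]]) auto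
    also have "\<dots> < \<infinity>" using fin[OF R(1)] by (simp add: ennreal_mult_less_top)
    finally have sq: "double_integral (sq_kernel u) ?B ?B < \<infinity>" .
    have emB: "emeasure (lebesgue_on ?B) ?B = emeasure lebesgue ?B"
      by (simp add: emeasure_restrict_space)
    have emB1: "emeasure lebesgue ?B < \<infinity>"
      using fmeasurableD2[OF lmeasurable_ball[of "0 :: real ^ 'n" R]] by (simp add: less_top)
    have emB0: "emeasure lebesgue ?B \<noteq> 0"
      using content_ball_pos[OF R(1), of "0 :: real ^ 'n"] emeasure_eq_measure2[OF lmeasurable_ball[of "0 :: real ^ 'n" R]] by auto
    \<comment> \<open>A finite double integral over a set of positive measure has a finite inner
      integral at some \<open>y\<close>. Subtracting the constant \<open>u y\<close> then bounds the
      square integral of \<open>u\<close> on the ball.\<close>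
    have "\<exists>y\<in>?B. (\<integral>\<^sup>+x. sq_kernel u x y \<partial>lebesgue_on ?B) < \<infinity>"
    proof (rule ccontr)
      assume "\<not> ?thesis"
      then have "double_integral (sq_kernel u) ?B ?B = (\<integral>\<^sup>+y. \<infinity> \<partial>lebesgue_on ?B)"
        unfolding double_integral_def by (intro nn_integral_cong) (auto simp: not_less top_unique)
      also have "\<dots> = \<infinity>" using emB0 by (simp add: emB[simplified])
      finally show False using sq by simp
    qed
    then obtain y where y: "y \<in> ?B" "(\<integral>\<^sup>+x. sq_kernel u x y \<partial>lebesgue_on ?B) < \<infinity>" by blast
    have um [measurable]: "u \<in> borel_measurable (lebesgue_on ?B)" using u by (rule measurable_restrict_space1)
    have sm [measurable]: "(\<lambda>x. sq_kernel u x y) \<in> borel_measurable (lebesgue_on ?B)"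
      by (rule leb_kernel_section[OF leb_kernel_sq_kernel[OF u]])
    have "(\<integral>\<^sup>+x. ennreal ((u x)\<^sup>2) \<partial>lebesgue_on ?B) \<le> (\<integral>\<^sup>+x. 2 * sq_kernel u x y + ennreal (2 * (u y)\<^sup>2) \<partial>lebesgue_on ?B)"
    proof (rule nn_integral_mono)
      fix x
      have "(u x)\<^sup>2 \<le> 2 * \<bar>u x - u y\<bar>\<^sup>2 + 2 * (u y)\<^sup>2"
        using sum_squares_bound[of "u x - u y" "u y"] by (simp add: power2_eq_square algebra_simps)
      then have "ennreal ((u x)\<^sup>2) \<le> ennreal (2 * \<bar>u x - u y\<bar>\<^sup>2 + 2 * (u y)\<^sup>2)" by (rule ennreal_leI)
      then show "ennreal ((u x)\<^sup>2) \<le> 2 * sq_kernel u x y + ennreal (2 * (u y)\<^sup>2)"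
        by (simp add: sq_kernel_def ennreal_plus ennreal_mult)
    qed
    also have "\<dots> = 2 * (\<integral>\<^sup>+x. sq_kernel u x y \<partial>lebesgue_on ?B) + ennreal (2 * (u y)\<^sup>2) * emeasure lebesgue ?B"
      by (subst nn_integral_add) (auto simp: nn_integral_cmult emB)
    also have "\<dots> < \<infinity>" using y(2) emB1 by (simp add: ennreal_mult_less_top)
    finally have uB: "(\<integral>\<^sup>+x. ennreal ((u x)\<^sup>2) \<partial>lebesgue_on ?B) < \<infinity>" .
    have Kl: "K \<in> sets lebesgue"
      using K by (intro sets_completionI_sets) (simp add: borel_compact)
    have "(\<integral>\<^sup>+x. ennreal (norm (indicator K x *\<^sub>R (u x)\<^sup>2)) \<partial>lebesgue) = (\<integral>\<^sup>+x. ennreal ((u x)\<^sup>2) \<partial>lebesgue_on K)"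
      using Kl by (subst nn_integral_restrict_space) (auto intro!: nn_integral_cong split: split_indicator)
    also have "\<dots> \<le> (\<integral>\<^sup>+x. ennreal ((u x)\<^sup>2) \<partial>lebesgue_on ?B)"
      by (rule nn_integral_lebesgue_on_subset[OF R(2) Kl]) simp
    also have "\<dots> < \<infinity>" by (rule uB)
    finally show ?thesis
      unfolding set_integrable_def using u Kl by (intro integrableI_bounded) simp_all
  qed
  then show ?thesis using u by (simp add: L2_loc_def)
qed

lemma ennreal_sqrt_le_iff:
  assumes "0 \<le> t"
  shows "ennreal_sqrt a \<le> ennreal t \<longleftrightarrow> a \<le> ennreal (t\<^sup>2)"
proof (cases a)
  case (real s)
  then have "ennreal_sqrt a \<le> ennreal t \<longleftrightarrow> sqrt s \<le> t" using assms by (simp add: ennreal_sqrt_def)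
  also have "\<dots> \<longleftrightarrow> s \<le> t\<^sup>2" using assms real by (metis real_sqrt_le_iff real_sqrt_abs abs_of_nonneg)
  finally show ?thesis using real by simp
qed (simp add: ennreal_sqrt_def top_unique)

text \<open>The two powers of the radius are inverse to each other, so they can be moved across the
  inequality. With a finite real \<open>t\<close> the equivalence both extracts the energy bound for
  \<open>u\<close> and returns the norm bound for the composition.\<close>

lemma Q_norm_le_iff:
  fixes u :: "real ^ 'n \<Rightarrow> real"
  assumes t: "0 \<le> t"
  shows "Q_norm \<alpha> u \<le> ennreal t \<longleftrightarrow>
    energy_le \<alpha> (t\<^sup>2) u"
proof -
  have eq: "(\<integral>\<^sup>+ y \<in> ball x0 r. (\<integral>\<^sup>+ x \<in> ball x0 r.
                 ennreal (\<bar>u x - u y\<bar>\<^sup>2 / norm (x - y) powr (real CARD('n) + 2 * \<alpha>)) \<partial>lebesgue) \<partial>lebesgue)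
      = double_integral (frac_kernel (CARD('n) + 2 * \<alpha>) u) (ball x0 r) (ball x0 r)" for x0 r
    by (simp add: double_integral_def frac_kernel_def nn_integral_restrict_space)
  have iff: "ennreal_sqrt (ennreal (r powr (2 * \<alpha> - real CARD('n))) * D) \<le> ennreal t
      \<longleftrightarrow> D \<le> ennreal (t\<^sup>2 * r powr (CARD('n) - 2 * \<alpha>))" if r: "0 < r" for r D
  proof -
    have "r powr (2 * \<alpha> - real CARD('n)) * (t\<^sup>2 * r powr (CARD('n) - 2 * \<alpha>)) = t\<^sup>2"
      using r by (simp add: mult.left_commute flip: powr_add)
    then have "ennreal (t\<^sup>2) = ennreal (r powr (2 * \<alpha> - real CARD('n))) * ennreal (t\<^sup>2 * r powr (CARD('n) - 2 * \<alpha>))"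
      by (simp flip: ennreal_mult)
    then show ?thesis
      unfolding ennreal_sqrt_le_iff[OF t] using r by (simp only:, subst ennreal_mult_le_mult_iff) auto
  qed
  show ?thesis
    unfolding Q_norm_def eq by (auto simp: energy_le_def SUP_le_iff iff)
qed

lemma radial_composition_Q:
  fixes \<alpha> \<beta> :: real and f :: "real ^ 'n \<Rightarrow> real ^ 'n"
  assumes d: "2 \<le> CARD('n)" and \<alpha>: "0 < \<alpha>" "\<alpha> < 1" and \<beta>: "\<beta> \<noteq> 0"
    and f: "\<And>z. z \<noteq> 0 \<Longrightarrow> f z = (norm z powr (\<beta> - 1)) *\<^sub>R z"
  shows "bounded_on_Q \<alpha> (composition_operator f)"
proof -
  define p where "p = CARD('n) + 2 * \<alpha>"
  define s where "s = CARD('n) - 2 * \<alpha>"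
  have dim: "2 \<le> DIM(real ^ 'n)" using d by simp
  obtain C where C: "0 < C"
    "\<And>(u :: real ^ 'n \<Rightarrow> real) M. u \<in> borel_measurable lebesgue \<Longrightarrow> 0 \<le> M \<Longrightarrow>
      energy_le \<alpha> M u \<Longrightarrow> energy_le \<alpha> (C * M) (u \<circ> radial_power \<beta>)"
    by (rule frac_energy_radial_power[where 'a="real ^ 'n", OF dim less_imp_le[OF \<alpha>(1)] \<alpha>(2) \<beta>]) (rule that)
  have "u \<circ> f \<in> Q_space \<alpha> \<and> Q_norm \<alpha> (u \<circ> f) \<le> ennreal (sqrt C) * Q_norm \<alpha> u" if u: "u \<in> Q_space \<alpha>" for u
  proof -
    define N where "N = enn2real (Q_norm \<alpha> u)"
    have N: "0 \<le> N" "Q_norm \<alpha> u = ennreal N" using u by (auto simp: N_def Q_space_def)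
    have um: "u \<in> borel_measurable lebesgue" using u by (simp add: Q_space_def L2_loc_def)
    have vm: "u \<circ> radial_power \<beta> \<in> borel_measurable lebesgue"
      using radial_power_measurable[OF \<beta>] um by (rule measurable_comp)
    \<comment> \<open>The value \<open>f 0\<close> is arbitrary, so the two compositions may differ
      at the origin; neither measurability nor the energies notice this.\<close>
    have uf: "u \<circ> f = (\<lambda>x. if x = 0 then u (f 0) else (u \<circ> radial_power \<beta>) x)"
      using f by (auto simp: radial_power_def)
    have fm: "u \<circ> f \<in> borel_measurable lebesgue"
      unfolding uf using vm by (intro measurable_If) (auto simp: o_def)
    have bd: "energy_le \<alpha> (N\<^sup>2) u"
      using Q_norm_le_iff[OF N(1), of \<alpha> u] N(2) by simp
    have E: "double_integral (frac_kernel p (u \<circ> f)) (ball x r) (ball x r) \<le> ennreal ((sqrt C * N)\<^sup>2 * r powr s)"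
      if r: "0 < r" for x r
    proof -
      have "double_integral (frac_kernel p (u \<circ> f)) (ball x r) (ball x r)
          = double_integral (frac_kernel p (u \<circ> f)) (ball x r - {0}) (ball x r - {0})"
        by (rule double_integral_Diff_singleton) auto
      also have "\<dots> \<le> double_integral (frac_kernel p (u \<circ> radial_power \<beta>)) (ball x r - {0}) (ball x r - {0})"
        by (rule double_integral_mono) (auto simp: uf frac_kernel_def)
      also have "\<dots> = double_integral (frac_kernel p (u \<circ> radial_power \<beta>)) (ball x r) (ball x r)"
        by (rule double_integral_Diff_singleton[symmetric]) auto
      also have "\<dots> \<le> ennreal (C * N\<^sup>2 * r powr s)"
        using energy_leD[OF C(2)[OF um _ bd] r] by (simp add: p_def s_def)
      also have "C * N\<^sup>2 = (sqrt C * N)\<^sup>2" using C(1) by (simp add: power_mult_distrib)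
      finally show ?thesis .
    qed
    have "u \<circ> f \<in> L2_loc"
      using \<alpha> by (intro L2_loc_if_frac_energy_finite[OF fm, of p] order.strict_trans1[OF E]) (auto simp: p_def)
    moreover have le: "Q_norm \<alpha> (u \<circ> f) \<le> ennreal (sqrt C * N)"
      using E C(1) N(1) by (subst Q_norm_le_iff) (auto simp: energy_le_def p_def s_def)
    moreover from le have "Q_norm \<alpha> (u \<circ> f) < \<infinity>"
      by (rule order.strict_trans1) simp
    ultimately show ?thesis
      using C(1) N by (simp add: Q_space_def ennreal_mult)
  qed
  then show ?thesis
    unfolding bounded_on_Q_def composition_operator_def using C(1) by (intro exI[of _ "sqrt C"]) auto
qed

theorem corollary1p4:
  fixes \<alpha> \<beta> :: real
    and f :: "real ^ 'n \<Rightarrow> real ^ 'n"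
  assumes "CARD('n) \<ge> 2"
    and "0 < \<alpha>" and "\<alpha> < 1"
    and "\<beta> \<noteq> 0"
    and "\<And>z. z \<noteq> 0 \<Longrightarrow> f z = (norm z powr (\<beta> - 1)) *\<^sub>R z"
  shows "bounded_on_Q \<alpha> (composition_operator f) \<and>
    (\<forall>g :: real ^ 'n \<Rightarrow> real.
       g \<in> Q_space \<alpha> \<longleftrightarrow> (\<lambda>x. g ((norm x powr (-2)) *\<^sub>R x)) \<in> Q_space \<alpha>)"
proof (intro conjI allI iffI)
  show "bounded_on_Q \<alpha> (composition_operator f)"
    by (rule radial_composition_Q[OF assms])
  let ?k = "\<lambda>x :: real ^ 'n. (norm x powr (-2)) *\<^sub>R x"
  \<comment> \<open>The inversion is the case \<open>\<beta> = -1\<close>, whose scalar factor has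
    exponent -2.\<close>
  have "bounded_on_Q \<alpha> (composition_operator ?k)"
    by (rule radial_composition_Q[OF assms(1-3), of "-1"]) auto
  then have k: "g \<circ> ?k \<in> Q_space \<alpha>" if "g \<in> Q_space \<alpha>" for g
    using that by (auto simp: bounded_on_Q_def composition_operator_def)
  \<comment> \<open>The inversion is an involution, at the origin too by the convention for
    \<open>powr\<close>; hence the converse implication is the direct one applied to the composed
    function.\<close>
  have kk: "?k (?k x) = x" for x
    using radial_power_inverse[of "-1" x] by (simp add: radial_power_def)
  fix g :: "real ^ 'n \<Rightarrow> real"
  show "(\<lambda>x. g (?k x)) \<in> Q_space \<alpha>" if "g \<in> Q_space \<alpha>"
    using k[OF that] by (simp add: o_def)
  show "g \<in> Q_space \<alpha>" if "(\<lambda>x. g (?k x)) \<in> Q_space \<alpha>"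
    using k[OF that] by (simp only: o_def kk)
qed

end
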